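(* Let $n>2$ be an integer and let $\mu$ be the normalized surface measure on $S^{n-1}$. (a) Let $t>0$. If $A\subset S^{n-1}$ is a Borel set with $\mu(A)\geq \frac12$, then $$\mu(A_t)\ \geq\ 1-\tfrac12\, e^{-nt^2/2}.$$ (b) Consequently, if $L>0$, $f:S^{n-1}\to\mathbb{R}$ is $L$-Lipschitz with respect to the geodesic distance, and $M$ is a median of $f$ (with respect to $\mu$), then for every $t\geq 0$ $$\mu(\{f>M+t\})\ \leq\ \tfrac12\, e^{-nt^2/(2L^2)}\qquad\text{and}\qquad \mu(\{|f-M|>t\})\ \leq\ e^{-nt^2/(2L^2)}.$$
   Context: $S^{n-1}$ is the unit Euclidean sphere in $\mathbb{R}^n$, equipped with the geodesic distance $\mathrm{dist}(x,y)=\arccos\langle x,y\rangle$ and the rotation-invariant Borel probability measure $\mu=\mu_n$. For $A\subset S^{n-1}$ and $t>0$, the $t$-enlargement is $A_t=\{x\in S^{n-1}: \mathrm{dist}(x,A)<t\}$. A median of $f$ is a real number $M$ with $\mu(\{f\geq M\})\geq\frac12$ and $\mu(\{f\leq M\})\geq \frac12$. *)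

theory Defs
  imports "HOL-Probability.Probability"
begin

text \<open>
  A Borel probability measure on the unit sphere is called rotation-invariant if it is preserved by
  every linear isometry. Such a measure is unique; existence is \<open>ex_sphere_prob\<close> below.
\<close>

definition sphere_prob :: "(real ^ 'n) measure \<Rightarrow> bool" where
  "sphere_prob \<mu> \<longleftrightarrow>
     prob_space \<mu> \<and>
     sets \<mu> = sets (restrict_space borel (sphere 0 1)) \<and>
     (\<forall>T. orthogonal_transformation T \<longrightarrow> distr \<mu> \<mu> T = \<mu>)"

definition geodist :: "real ^ 'n \<Rightarrow> real ^ 'n \<Rightarrow> real" where
  "geodist x y = arccos (x \<bullet> y)"

text \<open>
  The infimum is meaningful only for nonempty \<open>A\<close>, which holds whenever \<open>A\<close> has positive measure.
\<close>

definition enlargement :: "(real ^ 'n) set \<Rightarrow> real \<Rightarrow> (real ^ 'n) set" where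
  "enlargement A t = {x \<in> sphere 0 1. (INF a\<in>A. geodist x a) < t}"

text \<open>Only the values of \<open>f\<close> on the sphere matter in the following definitions.\<close>

definition geo_lipschitz :: "real \<Rightarrow> (real ^ 'n \<Rightarrow> real) \<Rightarrow> bool" where
  "geo_lipschitz L f \<longleftrightarrow>
     (\<forall>x \<in> sphere 0 1. \<forall>y \<in> sphere 0 1. \<bar>f x - f y\<bar> \<le> L * geodist x y)"

definition is_median :: "'a measure \<Rightarrow> ('a \<Rightarrow> real) \<Rightarrow> real \<Rightarrow> bool" where
  "is_median \<mu> f m \<longleftrightarrow>
     measure \<mu> {x \<in> space \<mu>. f x \<ge> m} \<ge> 1/2 \<and> measure \<mu> {x \<in> space \<mu>. f x \<le> m} \<ge> 1/2"

lemma space_sphere_prob: "sphere_prob \<mu> \<Longrightarrow> space \<mu> = sphere 0 1"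
  unfolding sphere_prob_def
  by (metis inf_top.right_neutral sets_eq_imp_space_eq space_borel space_restrict_space)

lemma sets_sphere_prob:
  assumes "sphere_prob \<mu>"
  shows "A \<in> sets \<mu> \<longleftrightarrow> A \<subseteq> sphere 0 1 \<and> A \<in> sets borel"
  using assms unfolding sphere_prob_def by (auto simp: sets_restrict_space_iff)

lemma nn_integral_lborel_shift:
  fixes f :: "'a :: euclidean_space \<Rightarrow> ennreal"
  assumes f: "f \<in> borel_measurable borel"
  shows "(\<integral>\<^sup>+x. f (c + x) \<partial>lborel) = (\<integral>\<^sup>+x. f x \<partial>lborel)"
  using f by (subst (2) lborel_distr_plus[of c, symmetric]) (simp add: nn_integral_distr)

lemma nn_integral_lborel_uminus:
  fixes f :: "'a :: euclidean_space \<Rightarrow> ennreal"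
  assumes f: "f \<in> borel_measurable borel"
  shows "(\<integral>\<^sup>+x. f (- x) \<partial>lborel) = (\<integral>\<^sup>+x. f x \<partial>lborel)"
proof -
  have "lborel = distr lborel borel (uminus :: 'a \<Rightarrow> 'a)"
    using lborel_affine_euclidean[where c = "\<lambda>_. -1" and t = "0 :: 'a"]
    by (simp add: euclidean_representation sum_negf density_1)
  then have "(\<integral>\<^sup>+x. f x \<partial>lborel) = (\<integral>\<^sup>+x. f x \<partial>distr lborel borel uminus)"
    by simp
  also have "\<dots> = (\<integral>\<^sup>+x. f (- x) \<partial>lborel)"
    using f by (simp add: nn_integral_distr)
  finally show ?thesis by simp
qed

text \<open>
  The library's invariance results for linear images of sets are restricted to well-ordered index
  types; the following argument avoids that restriction.
\<close>

lemma distr_lborel_orthogonal: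
  fixes T :: "'a :: euclidean_space \<Rightarrow> 'a"
  assumes T: "orthogonal_transformation T"
  shows "distr lborel borel T = lborel"
proof (rule measure_eqI)
  have mT [measurable]: "T \<in> borel_measurable borel"
    using T by (intro borel_measurable_continuous_onI linear_continuous_on)
      (simp add: linear_linear orthogonal_transformation_linear)
  have T_diff: "T (x - y) = T x - T y" for x y
    using T by (simp add: orthogonal_transformation_linear linear_diff)
  have T_surj: "T (inv T y) = y" for y
    using T by (simp add: orthogonal_transformation_surj surj_f_inv_f)
  have normT: "norm (T x) = norm x" for x
    using T by (rule orthogonal_transformation_norm)
  fix A :: "'a set" assume "A \<in> sets (distr lborel borel T)"
  then have A [measurable]: "A \<in> sets borel" by simp
  define B where "B = ball (0 :: 'a) 1"
  have B [measurable]: "B \<in> sets borel" by (simp add: B_def)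
  define a :: "'a \<Rightarrow> ennreal" where "a = indicator A"
  define b :: "'a \<Rightarrow> ennreal" where "b = indicator B"
  have [measurable]: "a \<in> borel_measurable borel" "b \<in> borel_measurable borel"
    by (simp_all add: a_def b_def)
  have bT: "b (T x) = b x" for x
    by (simp add: b_def B_def indicator_def normT)
  let ?m = "emeasure (distr lborel borel T) A"
  have m: "?m = (\<integral>\<^sup>+x. a (T x) \<partial>lborel)"
    by (subst nn_integral_distr[symmetric, where M' = borel]) (simp_all add: a_def)
  have "?m * emeasure lborel B = (\<integral>\<^sup>+x. a (T x) * (\<integral>\<^sup>+y. b y \<partial>lborel) \<partial>lborel)"
    by (simp add: m nn_integral_multc b_def)
  also have "\<dots> = (\<integral>\<^sup>+x. a (T x) * (\<integral>\<^sup>+y. b (T x + y) \<partial>lborel) \<partial>lborel)"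
    by (simp add: nn_integral_lborel_shift)
  also have "\<dots> = (\<integral>\<^sup>+x. \<integral>\<^sup>+y. a (T x) * b (T x + y) \<partial>lborel \<partial>lborel)"
    by (simp add: nn_integral_cmult)
  also have "\<dots> = (\<integral>\<^sup>+y. \<integral>\<^sup>+x. a (T x) * b (T x + y) \<partial>lborel \<partial>lborel)"
    by (rule lborel_pair.Fubini') measurable
  also have "\<dots> = (\<integral>\<^sup>+y. \<integral>\<^sup>+x. a (T (- inv T y + x)) * b (T (- inv T y + x) + y) \<partial>lborel \<partial>lborel)"
    by (subst nn_integral_lborel_shift[where f = "\<lambda>x. a (T x) * b (T x + y)" for y]) simp_all
  also have "\<dots> = (\<integral>\<^sup>+y. \<integral>\<^sup>+x. a (T x + - y) * b x \<partial>lborel \<partial>lborel)"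
    by (simp add: T_diff T_surj bT)
  also have "\<dots> = (\<integral>\<^sup>+x. \<integral>\<^sup>+y. a (T x + - y) * b x \<partial>lborel \<partial>lborel)"
    by (rule lborel_pair.Fubini') measurable
  also have "\<dots> = (\<integral>\<^sup>+x. (\<integral>\<^sup>+y. a (T x + - y) \<partial>lborel) * b x \<partial>lborel)"
    by (simp add: nn_integral_multc)
  also have "\<dots> = (\<integral>\<^sup>+x. (\<integral>\<^sup>+y. a y \<partial>lborel) * b x \<partial>lborel)"
    by (simp add: nn_integral_lborel_uminus[where f = "\<lambda>y. a (T x + y)" for x]
        nn_integral_lborel_shift del: add_uminus_conv_diff)
  also have "\<dots> = emeasure lborel A * emeasure lborel B"
    by (simp add: nn_integral_cmult a_def b_def)
  finally have "?m * emeasure lborel B = emeasure lborel A * emeasure lborel B" .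
  moreover have "emeasure lborel B \<noteq> 0" "emeasure lborel B \<noteq> \<infinity>"
    using content_ball_pos[of 1 "0 :: 'a"] emeasure_lborel_ball_finite[of "0 :: 'a" 1]
    by (auto simp: B_def measure_def)
  ultimately show "?m = emeasure lborel A"
    by (metis ennreal_mult_cancel_left infinity_ennreal_def mult.commute)
qed simp

lemma ex_sphere_prob: "\<exists>\<mu> :: (real ^ 'n) measure. sphere_prob \<mu>"
proof -
  define B where "B = ball (0 :: real ^ 'n) 1"
  define D where "D = uniform_measure lborel B"
  define S where "S = restrict_space borel (sphere (0 :: real ^ 'n) 1)"
  define e :: "real ^ 'n" where "e = axis undefined 1"
  define g where "g x = (if x = 0 then e else x /\<^sub>R norm x)" for x :: "real ^ 'n"
  have B: "emeasure lborel B \<noteq> 0" "emeasure lborel B \<noteq> \<infinity>" and B_sets: "B \<in> sets borel"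
    using content_ball_pos[of 1 "0 :: real ^ 'n"]
      emeasure_lborel_ball_finite[of "0 :: real ^ 'n" 1]
    by (auto simp: B_def measure_def)
  have D: "prob_space D" and sets_D: "sets D = sets borel"
    using prob_space_uniform_measure[OF B] by (auto simp: D_def)
  have g_sphere: "g x \<in> sphere 0 1" for x
    by (simp add: g_def e_def)
  have "g \<in> borel_measurable borel"
    unfolding g_def by measurable
  then have g: "g \<in> measurable D S"
    unfolding S_def using g_sphere
    by (intro measurable_restrict_space2) (auto simp: measurable_cong_sets[OF sets_D refl])
  define \<nu> where "\<nu> = distr D S g"
  have "distr \<nu> \<nu> T = \<nu>" if T: "orthogonal_transformation T" for T
  proof -
    have normT: "norm (T x) = norm x" for x
      using T by (rule orthogonal_transformation_norm)
    have T_borel: "T \<in> borel_measurable borel"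
      using T by (intro borel_measurable_continuous_onI linear_continuous_on)
        (simp add: linear_linear orthogonal_transformation_linear)
    then have T_S: "T \<in> measurable S S"
      unfolding S_def using normT
      by (intro measurable_restrict_space2 measurable_restrict_space1)
        (auto simp: space_restrict_space)
    have T_D: "T \<in> measurable D D"
      using T_borel by (simp add: measurable_cong_sets[OF sets_D sets_D])
    have D_inv: "distr D D T = D"
    proof (rule measure_eqI)
      fix A assume "A \<in> sets (distr D D T)"
      then have A: "A \<in> sets borel" by (simp add: sets_D)
      have vA: "T -` A \<in> sets borel"
        using measurable_sets[OF T_borel A] by simp
      have BT: "B \<inter> T -` A = T -` (B \<inter> A)"
        by (auto simp: B_def normT)
      have "emeasure lborel (T -` (B \<inter> A)) = emeasure (distr lborel borel T) (B \<inter> A)"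
        using T_borel A B_sets by (subst emeasure_distr) auto
      also have "\<dots> = emeasure lborel (B \<inter> A)"
        by (simp add: distr_lborel_orthogonal[OF T])
      finally have eq: "emeasure lborel (B \<inter> T -` A) = emeasure lborel (B \<inter> A)"
        by (simp add: BT)
      have "emeasure (distr D D T) A = emeasure D (T -` A)"
        using T_D A by (subst emeasure_distr) (auto simp: sets_D D_def)
      also have "\<dots> = emeasure D A"
        unfolding D_def using A vA B_sets eq by simp
      finally show "emeasure (distr D D T) A = emeasure D A" .
    qed (simp add: sets_D)
    have "AE x in lborel. x \<noteq> (0 :: real ^ 'n)"
      by (rule AE_lborel_singleton)
    then have "AE x in D. x \<noteq> 0"
      unfolding D_def using B_sets by (intro AE_uniform_measureI) auto
    then have ae: "AE x in D. (T \<circ> g) x = (g \<circ> T) x"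
    proof (rule eventually_mono)
      fix x :: "real ^ 'n" assume "x \<noteq> 0"
      moreover from this have "T x \<noteq> 0"
        using normT[of x] by (metis norm_eq_zero)
      ultimately show "(T \<circ> g) x = (g \<circ> T) x"
        by (simp add: g_def normT orthogonal_transformation_scaleR[OF T])
    qed
    have "distr \<nu> \<nu> T = distr \<nu> S T"
      by (rule distr_cong) (auto simp: \<nu>_def)
    also have "\<dots> = distr D S (T \<circ> g)"
      unfolding \<nu>_def by (rule distr_distr[OF T_S g])
    also have "\<dots> = distr D S (g \<circ> T)"
      using ae g T_S T_D by (intro distr_cong_AE) auto
    also have "\<dots> = distr (distr D D T) S g"
      by (rule distr_distr[OF g T_D, symmetric])
    also have "\<dots> = \<nu>"
      by (simp add: D_inv \<nu>_def)
    finally show ?thesis .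
  qed
  moreover have "prob_space \<nu>"
    unfolding \<nu>_def by (rule prob_space.prob_space_distr[OF D g])
  moreover have "sets \<nu> = sets (restrict_space borel (sphere 0 1))"
    by (simp add: \<nu>_def S_def)
  ultimately show ?thesis
    unfolding sphere_prob_def by blast
qed

end

theory Submission
  imports Defs
begin

text \<open>
  Part (a) is L\'evy's isoperimetric inequality followed by a sharp estimate of cap measures.

  For the isoperimetric inequality, a set \<open>A\<close> of measure at least \<open>1/2\<close> is polarized with respect to
  hyperplanes. A polarization keeps the measure and does not increase the measure of the enlargement.
  Let \<open>d\<close> be the mass of the hemisphere \<open>C\<close> missed by \<open>A\<close>. The law of the reflection of a point in a
  random hyperplane dominates a fixed multiple of the invariant measure, so some polarization lowers
  \<open>d\<close> by a fixed multiple of $d^2$; hence the infimum of \<open>d\<close> over iterated polarizations is zero and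
  the enlargement of \<open>A\<close> has at least the measure of that of \<open>C\<close>.

  Rotation invariance determines the moments of a coordinate; by Weierstrass approximation it is
  distributed like $\sin\theta$ for the density $\cos^{n-2}\theta$ on $[-\pi/2, \pi/2]$. The function
  $e^{-nt^2/2} \int_0^{\pi/2} \cos^{n-2} - \int_t^{\pi/2} \cos^{n-2}$ vanishes at \<open>0\<close>, is positive at
  $\pi/2$, and for $n \ge 4$ it first increases and then decreases; the case $n = 3$ is elementary.
\<close>

subsection \<open>The tail of a power of the cosine\<close>

lemma sin_upper_taylor: "sin x \<le> x - x ^ 3 / 6 + x ^ 5 / 120" if "0 \<le> x" for x :: real
proof -
  have "(\<Sum>m<5. sin_coeff m * x ^ m) = x - x ^ 3 / 6"
    by (simp add: sin_coeff_def lessThan_nat_numeral fact_numeral)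
  then have "\<bar>sin x - (x - x ^ 3 / 6)\<bar> \<le> x ^ 5 / 120"
    using Maclaurin_sin_bound[of x 5] that by (simp add: fact_numeral)
  then show ?thesis by linarith
qed

lemma sin_lower_taylor: "x - x ^ 3 / 6 \<le> sin x" if "0 \<le> x" for x :: real
proof -
  have "(\<Sum>m<3. sin_coeff m * x ^ m) = x"
    by (simp add: sin_coeff_def lessThan_nat_numeral fact_numeral)
  then have "\<bar>sin x - x\<bar> \<le> x ^ 3 / 6"
    using Maclaurin_sin_bound[of x 3] that by (simp add: fact_numeral)
  then show ?thesis by linarith
qed

lemma cos_upper_taylor: "cos x \<le> 1 - x ^ 2 / 2 + x ^ 4 / 24" for x :: real
proof -
  obtain s where s: "cos x = (\<Sum>m<4. cos_coeff m * x ^ m) + cos (s + 1/2 * real 4 * pi) / fact 4 * x ^ 4"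
    using Maclaurin_cos_expansion[of x 4] by blast
  have sum: "(\<Sum>m<4. cos_coeff m * x ^ m) = 1 - x ^ 2 / 2"
    by (simp add: cos_coeff_def lessThan_nat_numeral fact_numeral)
  have "cos (s + 1/2 * real 4 * pi) / fact 4 * x ^ 4 \<le> 1 / fact 4 * x ^ 4"
    by (intro mult_right_mono divide_right_mono) auto
  then show ?thesis
    using s sum by (simp add: fact_numeral)
qed

lemma cos_lower_taylor: "1 - x ^ 2 / 2 \<le> cos x" for x :: real
proof -
  have "cos x = 1 - 2 * sin (x/2) ^ 2"
    using cos_double_sin[of "x/2"] by simp
  moreover have "sin (x/2) ^ 2 \<le> (x/2) ^ 2"
    using abs_sin_x_le_abs_x[of "x/2"] by (metis abs_le_square_iff)
  ultimately show ?thesis by (simp add: power_divide)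
qed

text \<open>
  With \<open>t = pi/2 - 2 v\<close> the claim is $(3\pi/2 - 6v) \sin v \le \cos v$. The two sides are closest
  where $\tan v = 1/\sqrt 5$, that is for \<open>v\<close> near \<open>21/50\<close>, so a factor $(v - 21/50)^2$ is split off from
  the difference of the Taylor polynomials.
\<close>

lemma three_mult_one_minus_sin_le_cos:
  fixes t :: real
  assumes "0 \<le> t" "t \<le> pi/2"
  shows "3 * t * (1 - sin t) \<le> cos t"
proof -
  define v where "v = (pi/2 - t) / 2"
  have t: "t = pi/2 - 2 * v" by (simp add: v_def field_simps)
  \<comment> \<open>\<open>393/500\<close> is a rational upper bound for
    \<open>pi/4\<close>.\<close>
  have v: "0 \<le> v" "v \<le> 393/500" using assms pi_approx by (auto simp: v_def)
  have sv: "0 \<le> sin v" using v pi_approx by (intro sin_ge_zero) auto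
  have st: "1 - sin t = 2 * sin v ^ 2" 
    unfolding t by (simp add: sin_diff cos_double_sin)
  have ct: "cos t = 2 * sin v * cos v" 
    unfolding t by (simp add: cos_diff sin_double)
  define S where "S = v - v ^ 3 / 6 + v ^ 5 / 120"
  have vv: "v * v \<le> 1" using v by (simp add: mult_le_one)
  have S: "sin v \<le> S" unfolding S_def using sin_upper_taylor v by blast
  \<comment> \<open>\<open>47125/10000\<close> is slightly larger than
    \<open>3 * pi / 2\<close>.\<close>
  have "3 * t * sin v \<le> (47125/10000 - 6 * v) * S"
    using S sv pi_approx assms by (intro mult_mono) (auto simp: t)
  also have "\<dots> \<le> 1 - v ^ 2 / 2"
  proof -
    have q: "561891201/100000000 - 1808771/24000000 * v - 82639/80000 * v^2 - 377/9600 * v^3 \<ge> (0::real)"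
    proof -
      have "v^2 \<le> v" "v^3 \<le> v"
        using v power_decreasing[of 1 _ v] by auto
      then show ?thesis using v by linarith
    qed
    \<comment> \<open>With \<open>v ^ 6 / 20\<close> set aside, the remaining quintic is divided by
      \<open>(v - 21/50)^2\<close>; the quotient is the cubic in \<open>q\<close>, and the linear
      remainder has positive coefficients.\<close>
    have "1 - v ^ 2 / 2 - (47125/10000 - 6 * v) * S =
      (v - 21/50)^2 * (561891201/100000000 - 1808771/24000000 * v - 82639/80000 * v^2 - 377/9600 * v^3)
       + v ^ 6 / 20 + (2205980359/250000000000 + 82722221/4000000000 * v)"
      unfolding S_def by (simp add: eval_nat_numeral) (simp add: field_simps)
    moreover have "0 \<le> (v - 21/50)^2 * (561891201/100000000 - 1808771/24000000 * v - 82639/80000 * v^2 - 377/9600 * v^3)"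
      using q by simp
    moreover have "0 \<le> v ^ 6" using v by simp
    ultimately show ?thesis using v(1) by linarith
  qed
  also have "\<dots> \<le> cos v" by (rule cos_lower_taylor)
  finally have "2 * sin v * (3 * t * sin v) \<le> 2 * sin v * cos v"
    using sv by (intro mult_left_mono) auto
  then show ?thesis unfolding st ct by (simp add: power2_eq_square mult_ac)
qed

text \<open>This is the tail estimate for exponent 1, the case \<open>n = 3\<close>:
  \<open>(1 - sin s) * exp (3 * s\<^sup>2 / 2)\<close> is nonincreasing by the preceding inequality
  and equals 1 at 0.\<close>

lemma one_minus_sin_le_exp:
  fixes t :: real
  assumes "0 \<le> t" "t \<le> pi/2"
  shows "1 - sin t \<le> exp (- (3 * t\<^sup>2 / 2))"
proof -
  define g where "g s = (1 - sin s) * exp (3 * s\<^sup>2 / 2)" for s :: real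
  have "g t \<le> g 0"
  proof (rule DERIV_nonpos_imp_nonincreasing[OF assms(1)])
    fix s assume s: "0 \<le> s" "s \<le> t"
    have "(g has_real_derivative (3 * s * (1 - sin s) - cos s) * exp (3 * s\<^sup>2 / 2)) (at s)"
      unfolding g_def by (auto intro!: derivative_eq_intros simp: algebra_simps)
    moreover have "(3 * s * (1 - sin s) - cos s) * exp (3 * s\<^sup>2 / 2) \<le> 0"
      using three_mult_one_minus_sin_le_cos[of s] s assms by (simp add: mult_nonpos_nonneg)
    ultimately show "\<exists>y. (g has_real_derivative y) (at s) \<and> y \<le> 0" by blast
  qed
  then show ?thesis by (simp add: g_def exp_minus field_simps)
qed

text \<open>For \<open>0 < t < pi/2\<close> this is \<open>2 * tan t - 4 * t + 1 / t \<ge> 0\<close>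
  multiplied by \<open>t * cos t\<close>. Taylor bounds are needed only where
  \<open>4 * t\<^sup>2 > 1\<close>.\<close>

lemma four_sq_minus_one_cos_le:
  fixes t :: real
  assumes "0 \<le> t" "t \<le> pi/2"
  shows "(4 * t\<^sup>2 - 1) * cos t \<le> 2 * t * sin t"
proof (cases "4 * t\<^sup>2 \<le> 1")
  case True
  then have "(4 * t\<^sup>2 - 1) * cos t \<le> 0"
    using assms by (intro mult_nonpos_nonneg cos_ge_zero) auto
  also have "0 \<le> 2 * t * sin t"
    using assms by (auto intro!: mult_nonneg_nonneg sin_ge_zero)
  finally show ?thesis .
next
  case False
  define y where "y = t\<^sup>2"
  have "t \<le> 2" using assms pi_approx by auto
  then have y: "0 \<le> y" "y \<le> 4" using assms power_mono[of t 2 2] by (auto simp: y_def)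
  have "(4 * t\<^sup>2 - 1) * cos t \<le> (4 * t\<^sup>2 - 1) * (1 - t ^ 2 / 2 + t ^ 4 / 24)"
    using False cos_upper_taylor by (intro mult_left_mono) auto
  also have "\<dots> \<le> 2 * t * (t - t ^ 3 / 6)"
  proof -
    \<comment> \<open>As a cubic in \<open>y\<close> the difference has its local minimum at
      \<open>y = 5/6\<close>, with value \<open>17/2592\<close>, so expanding there leaves no linear
      term.\<close>
    have "2 * t * (t - t ^ 3 / 6) - (4 * t\<^sup>2 - 1) * (1 - t ^ 2 / 2 + t ^ 4 / 24)
      = (y - 5/6)\<^sup>2 * (103/72 - y / 6) + 17/2592"
      unfolding y_def by (simp add: eval_nat_numeral) (simp add: field_simps)
    also have "\<dots> \<ge> 0" using y by simp
    finally show ?thesis by linarith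
  qed
  also have "\<dots> \<le> 2 * t * sin t"
    using assms sin_lower_taylor by (intro mult_left_mono) auto
  finally show ?thesis .
qed

text \<open>The logarithmic derivative of the quotient is $(N-2)(\tan t - t) + 2 \tan t - 4t + 1/t$.\<close>

lemma gauss_cos_quotient_mono:
  fixes N :: nat and s t :: real
  assumes N: "2 \<le> N" and st: "0 < s" "s \<le> t" "t < pi/2"
  shows "s * exp (- (real (N + 2) * s\<^sup>2 / 2)) / cos s ^ N \<le> t * exp (- (real (N + 2) * t\<^sup>2 / 2)) / cos t ^ N"
proof -
  define g where "g r = ln r - real (N + 2) * r\<^sup>2 / 2 - real N * ln (cos r)" for r :: real
  have cos_pos: "cos r > 0" if "s \<le> r" "r \<le> t" for r
    using that st by (intro cos_gt_zero) auto
  have exp_g: "exp (g r) = r * exp (- (real (N + 2) * r\<^sup>2 / 2)) / cos r ^ N" if "s \<le> r" "r \<le> t" for r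
  proof -
    have "exp (g r) = exp (ln r) * exp (- (real (N + 2) * r\<^sup>2 / 2)) / exp (ln (cos r)) ^ N"
      unfolding g_def exp_diff by (simp add: exp_of_nat_mult exp_minus field_simps)
    then show ?thesis using cos_pos[OF that] that st by simp
  qed
  have "g s \<le> g t"
  proof (rule DERIV_nonneg_imp_nondecreasing[OF st(2)])
    fix r assume r: "s \<le> r" "r \<le> t"
    then have r0: "0 < r" "r < pi/2" using st by auto
    have "(g has_real_derivative (1 / r - real (N + 2) * r + real N * tan r)) (at r)"
      unfolding g_def using r0 cos_pos[OF r] by (auto intro!: derivative_eq_intros simp: tan_def)
    moreover have "0 \<le> 1 / r - real (N + 2) * r + real N * tan r"
    proof -
      have "r \<le> tan r" using abs_tan_ge[of r] r0 tan_gt_zero[of r] by auto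
      then have "0 \<le> (real N - 2) * (tan r - r)" using N by (intro mult_nonneg_nonneg) auto
      moreover have "0 \<le> 2 * tan r - 4 * r + 1 / r"
      proof -
        have "2 * tan r - 4 * r + 1 / r = (2 * r * sin r - (4 * r\<^sup>2 - 1) * cos r) / (r * cos r)"
          using r0 cos_pos[OF r] by (simp add: tan_def field_simps power2_eq_square)
        also have "\<dots> \<ge> 0"
          using four_sq_minus_one_cos_le[of r] r0 cos_pos[OF r] by simp
        finally show ?thesis .
      qed
      ultimately show ?thesis by (simp add: algebra_simps)
    qed
    ultimately show "\<exists>y. (g has_real_derivative y) (at r) \<and> 0 \<le> y" by blast
  qed
  then have "exp (g s) \<le> exp (g t)" by simp
  then show ?thesis using exp_g[of s] exp_g[of t] st by simp
qed

lemma integral_cos_power_pos: "0 < integral {0..pi/2} (\<lambda>\<theta>. cos \<theta> ^ N)"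
proof -
  have "0 \<le> integral {0..pi/2} (\<lambda>\<theta>. cos \<theta> ^ N)"
    by (intro integral_nonneg integrable_continuous_interval continuous_intros zero_le_power cos_ge_zero) auto
  moreover have "integral {0..pi/2} (\<lambda>\<theta>. cos \<theta> ^ N) \<noteq> 0"
  proof
    assume *: "integral {0..pi/2} (\<lambda>\<theta>. cos \<theta> ^ N) = 0"
    have "\<forall>x\<in>{0..pi/2}. cos x ^ N = (0::real)"
      by (subst integral_eq_0_iff[symmetric, OF _ _ _])
        (auto intro!: continuous_intros zero_le_power cos_ge_zero simp: * simp del: zero_le_power_eq)
    from bspec[OF this, of 0] show False by simp
  qed
  ultimately show ?thesis by (simp add: less_le)
qed

text \<open>Let \<open>H\<close> be the right side minus the left side. It is 0 at 0 and positive at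
  \<open>pi/2\<close>. If it were negative at \<open>t\<close>, the mean value theorem would give a
  negative slope before \<open>t\<close> and a positive one after it. For \<open>N \<ge> 2\<close>
  this is impossible, since \<open>H'\<close> has the sign of \<open>1 - C * a * q\<close> with
  \<open>q\<close> nondecreasing.\<close>

lemma integral_cos_power_tail:
  fixes N :: nat and t :: real
  assumes N: "1 \<le> N" and t: "0 \<le> t" "t \<le> pi/2"
  shows "integral {t..pi/2} (\<lambda>\<theta>. cos \<theta> ^ N)
    \<le> exp (- (real (N + 2) * t\<^sup>2 / 2)) * integral {0..pi/2} (\<lambda>\<theta>. cos \<theta> ^ N)"
proof (cases "N = 1")
  case True
  have I: "integral {s..pi/2} cos = 1 - sin s" if "s \<le> pi/2" for s :: real
    using fundamental_theorem_of_calculus[of s "pi/2" sin cos] that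
    by (auto intro!: integral_unique derivative_eq_intros simp flip: has_real_derivative_iff_has_vector_derivative)
  show ?thesis using one_minus_sin_le_exp[OF t] I[of t] I[of 0] t True by simp
next
  case False
  define w where "w = (\<lambda>\<theta>::real. cos \<theta> ^ N)"
  define C where "C = integral {0..pi/2} w"
  define a where "a = real (N + 2)"
  \<comment> \<open>The tail is written as \<open>C - integral {0..s} w\<close>, so that the
    integral has a variable upper limit.\<close>
  define H where "H s = exp (- (a * s\<^sup>2 / 2)) * C - (C - integral {0..s} w)" for s
  have C: "C > 0" unfolding C_def w_def by (rule integral_cos_power_pos)
  have wi: "w integrable_on {x..y}" for x y
    unfolding w_def by (intro integrable_continuous_interval continuous_intros)
  have tail: "integral {s..pi/2} w = C - integral {0..s} w" if "0 \<le> s" "s \<le> pi/2" for s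
    using Henstock_Kurzweil_Integration.integral_combine[OF that wi] by (simp add: C_def)
  have H': "(H has_real_derivative w s - C * (a * s * exp (- (a * s\<^sup>2 / 2)))) (at s)"
    if "0 < s" "s < pi/2" for s
  proof -
    have "((\<lambda>u. integral {0..u} w) has_real_derivative w s) (at s within {0..pi/2})"
      by (rule integral_has_real_derivative) (use that in \<open>auto simp: w_def intro!: continuous_intros\<close>)
    then have "((\<lambda>u. integral {0..u} w) has_real_derivative w s) (at s)"
      using that by (simp add: at_within_interior[of s "{0..pi/2}"])
    then show ?thesis unfolding H_def
      by (auto intro!: derivative_eq_intros)
  qed
  have Hc: "continuous_on {x..y} H" if "0 \<le> x" "y \<le> pi/2" for x y
    unfolding H_def
    by (intro continuous_intros continuous_on_subset[OF indefinite_integral_continuous_1[OF wi, of 0 "pi/2"]])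
      (use that in auto)
  define q where "q s = s * exp (- (a * s\<^sup>2 / 2)) / cos s ^ N" for s
  have q: "w s - C * (a * s * exp (- (a * s\<^sup>2 / 2))) = w s * (1 - C * a * q s)"
    if "0 < s" "s < pi/2" for s
    using cos_gt_zero[OF that] by (simp add: w_def q_def field_simps)
  have w_pos: "w s > 0" if "0 < s" "s < pi/2" for s
    using cos_gt_zero[OF that] by (simp add: w_def)
  have "H t \<ge> 0"
  proof (rule ccontr)
    assume neg: "\<not> H t \<ge> 0"
    have H0: "H 0 = 0" by (simp add: H_def)
    have H1: "H (pi/2) > 0" using C by (simp add: H_def C_def)
    have "t \<noteq> 0" "t \<noteq> pi/2" using neg H0 H1 by (metis order.refl, metis less_imp_le)
    then have tt: "0 < t" "t < pi/2" using t by linarith+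
    obtain l z where z: "0 < z" "z < t" "(H has_real_derivative l) (at z)" "H t - H 0 = (t - 0) * l"
      using MVT[OF tt(1) Hc] tt H' by (meson less_trans order.refl less_imp_le real_differentiable_def)
    obtain l' z' where z': "t < z'" "z' < pi/2" "(H has_real_derivative l') (at z')" "H (pi/2) - H t = (pi/2 - t) * l'"
      using MVT[OF tt(2) Hc] tt H' by (meson less_trans order.refl less_imp_le real_differentiable_def)
    have "t * l < 0" using z(4) neg H0 by simp
    then have "l < 0" using tt by (simp add: mult_less_0_iff)
    have "0 < (pi/2 - t) * l'" using z'(4) neg H1 by simp
    then have "l' > 0" using tt by (simp add: zero_less_mult_iff)
    have "l = w z * (1 - C * a * q z)"
      using DERIV_unique[OF z(3) H'] q[of z] z tt by simp
    with \<open>l < 0\<close> w_pos[of z] z tt have 1: "C * a * q z > 1" by (simp add: mult_less_0_iff)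
    have "l' = w z' * (1 - C * a * q z')"
      using DERIV_unique[OF z'(3) H'] q[of z'] z' tt by simp
    with \<open>l' > 0\<close> w_pos[of z'] z' tt have 2: "C * a * q z' < 1" by (simp add: zero_less_mult_iff)
    have "q z \<le> q z'"
      unfolding q_def a_def using gauss_cos_quotient_mono[of N z z'] N False z z' by simp
    then have "C * a * q z \<le> C * a * q z'"
      using C by (intro mult_left_mono) (auto simp: a_def)
    with 1 2 show False by simp
  qed
  then show ?thesis using tail[OF t] unfolding H_def a_def by (simp add: C_def w_def)
qed

subsection \<open>Invariant measures and the law of a coordinate\<close>

text \<open>Dividing by \<open>u \<bullet> u\<close> admits normals of any length, in particular
  differences of points; \<open>u = 0\<close> yields the identity.\<close>

definition reflect :: "'a :: euclidean_space \<Rightarrow> 'a \<Rightarrow> 'a" where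
  "reflect u x = x - (2 * (x \<bullet> u) / (u \<bullet> u)) *\<^sub>R u"

lemma inner_reflect: "reflect u x \<bullet> y = x \<bullet> y - 2 * (x \<bullet> u) * (y \<bullet> u) / (u \<bullet> u)"
  by (simp add: reflect_def inner_diff_left inner_commute[of u y])

lemma inner_reflect_commute: "reflect u x \<bullet> y = x \<bullet> reflect u y"
  using inner_reflect[of u x y] inner_reflect[of u y x] by (simp add: inner_commute mult_ac)

lemma reflect_reflect [simp]: "reflect u (reflect u x) = x"
  by (cases "u = 0") (simp_all add: reflect_def inner_diff_left)

lemma inner_reflect_reflect [simp]: "reflect u x \<bullet> reflect u y = x \<bullet> y"
  by (simp add: inner_reflect_commute[symmetric])

lemma orthogonal_transformation_reflect: "orthogonal_transformation (reflect u)"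
proof -
  have "linear (reflect u)"
  proof (rule linearI)
    show "reflect u (x + y) = reflect u x + reflect u y" for x y
      by (simp add: reflect_def inner_add_left distrib_left add_divide_distrib scaleR_left_distrib)
    show "reflect u (c *\<^sub>R x) = c *\<^sub>R reflect u x" for c x
      by (simp add: reflect_def scaleR_right_diff_distrib mult.left_commute)
  qed
  then show ?thesis by (simp add: orthogonal_transformation_def)
qed

lemma norm_reflect [simp]: "norm (reflect u x) = norm x"
  by (simp add: norm_eq_sqrt_inner)

text \<open>The perpendicular bisector of two points of equal norm passes through the
  origin.\<close>

lemma reflect_swap:
  assumes "norm x = norm y"
  shows "reflect (x - y) x = y"
proof (cases "x = y")
  case False
  have "x \<bullet> x = y \<bullet> y" using assms by (simp add: norm_eq_sqrt_inner)
  then have "2 * (x \<bullet> (x - y)) = (x - y) \<bullet> (x - y)"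
    by (simp add: inner_diff_left inner_diff_right inner_commute)
  with False show ?thesis by (simp add: reflect_def)
qed (simp add: reflect_def)

lemma reflect_inner_self: "reflect u x \<bullet> u = - (x \<bullet> u)"
  by (cases "u = 0") (simp_all add: inner_reflect)

lemma measurable_reflect [measurable]: "(\<lambda>(u, x). reflect u x) \<in> borel_measurable (borel \<Otimes>\<^sub>M borel)"
  unfolding reflect_def by measurable

text \<open>The measure is carried on the whole space, with the sphere as a set of full measure, so
  that measurability means Borel measurability and no restricted spaces occur.\<close>

locale invariant_sphere_prob = prob_space M for M :: "'a :: euclidean_space measure" +
  assumes sets_M [measurable_cong]: "sets M = sets borel"
    and AE_sphere: "AE x in M. norm x = 1"
    and distr_orthogonal: "orthogonal_transformation T \<Longrightarrow> distr M borel T = M"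
begin

lemma space_M [simp]: "space M = UNIV"
  using sets_eq_imp_space_eq[OF sets_M] by simp

lemma measurable_orthogonal:
  assumes "orthogonal_transformation T"
  shows "T \<in> borel_measurable M"
  using assms orthogonal_transformation_linear[OF assms]
  by (auto simp: measurable_cong_sets[OF sets_M refl] linear_linear
    intro!: borel_measurable_continuous_onI linear_continuous_on)

lemma integral_orthogonal:
  fixes f :: "'a \<Rightarrow> real"
  assumes T: "orthogonal_transformation T" and f: "f \<in> borel_measurable borel"
  shows "(\<integral>x. f (T x) \<partial>M) = (\<integral>x. f x \<partial>M)"
  using integral_distr[OF measurable_orthogonal[OF T] f] distr_orthogonal[OF T] by simp

lemma measure_orthogonal:
  assumes T: "orthogonal_transformation T" and A: "A \<in> sets borel"
  shows "measure M {x. T x \<in> A} = measure M A"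
proof -
  have "measure M A = measure (distr M borel T) A" using distr_orthogonal[OF T] by simp
  also have "\<dots> = measure M {x. T x \<in> A}"
    by (subst measure_distr[OF measurable_orthogonal[OF T] A]) (simp add: vimage_def)
  finally show ?thesis by simp
qed

lemma integrable_continuous:
  fixes f :: "'a \<Rightarrow> real"
  assumes f: "continuous_on UNIV f"
  shows "integrable M f"
proof -
  have "compact (f ` sphere 0 1)"
    by (intro compact_continuous_image continuous_on_subset[OF f]) auto
  then obtain B where B: "\<forall>y\<in>f ` sphere 0 1. norm y \<le> B"
    using compact_imp_bounded bounded_iff by blast
  have "AE x in M. norm (f x) \<le> B" using AE_sphere by eventually_elim (use B in auto)
  then show ?thesis
    by (rule integrable_const_bound)
      (use f in \<open>auto simp: measurable_cong_sets[OF sets_M refl] intro: borel_measurable_continuous_onI\<close>)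
qed

text \<open>The reflection that exchanges \<open>v\<close> and \<open>e\<close> preserves
  \<open>M\<close>.\<close>

lemma moment_unit:
  assumes "norm v = 1" "norm e = 1"
  shows "(\<integral>x. (x \<bullet> v) ^ k \<partial>M) = (\<integral>x. (x \<bullet> e) ^ k \<partial>M)"
proof -
  have "(\<integral>x. (x \<bullet> e) ^ k \<partial>M) = (\<integral>x. (reflect (v - e) x \<bullet> e) ^ k \<partial>M)"
    by (intro integral_orthogonal[symmetric] orthogonal_transformation_reflect) simp
  also have "\<dots> = (\<integral>x. (x \<bullet> v) ^ k \<partial>M)"
  proof -
    have "reflect (v - e) e = v"
      using reflect_swap[of v e] assms by (metis reflect_reflect)
    then show ?thesis by (simp add: inner_reflect_commute)
  qed
  finally show ?thesis by simp
qed

text \<open>The antipodal map preserves \<open>M\<close> and changes the sign of the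
  integrand.\<close>

lemma moment_odd:
  assumes "odd k"
  shows "(\<integral>x. (x \<bullet> e) ^ k \<partial>M) = 0"
proof -
  have "(\<integral>x. (x \<bullet> e) ^ k \<partial>M) = (\<integral>x. (- x \<bullet> e) ^ k \<partial>M)"
    by (intro integral_orthogonal[symmetric]) (simp_all add: orthogonal_transformation_neg)
  then show ?thesis using assms by (simp add: power_minus_odd)
qed

text \<open>
  Rotation invariance gives $E (X + \tau Y)^{2j} = (1 + \tau^2)^j E X^{2j}$ for two orthonormal
  coordinates; the identity below compares the coefficients of $\tau^2$.
\<close>

lemma mixed_moment:
  assumes e: "norm e = 1" and i: "norm i = 1" and ei: "e \<bullet> i = 0"
  shows "real ((2 * j) choose 2) * (\<integral>x. (x \<bullet> e) ^ (2 * j - 2) * (x \<bullet> i)\<^sup>2 \<partial>M) = real j * (\<integral>x. (x \<bullet> e) ^ (2 * j) \<partial>M)"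
proof -
  define c where "c l = real ((2 * j) choose l) * (\<integral>x. (x \<bullet> e) ^ (2 * j - l) * (x \<bullet> i) ^ l \<partial>M)" for l
  define m where "m = (\<integral>x. (x \<bullet> e) ^ (2 * j) \<partial>M)"
  \<comment> \<open>\<open>p\<close> is the expansion of the moment of
    \<open>x \<bullet> (e + \<tau> *\<^sub>R i)\<close> in powers of \<open>\<tau>\<close>, and
    \<open>q\<close> is its closed form from rotation invariance. They agree at every real
    \<open>\<tau>\<close>, hence as polynomials.\<close>
  define p where "p = (\<Sum>l\<le>2*j. monom (c l) l)"
  define q where "q = smult m ([:1, 0, 1:] ^ j)"
  have "poly p \<tau> = poly q \<tau>" for \<tau>
  proof -
    define v where "v = e + \<tau> *\<^sub>R i"
    have nv: "(norm v)\<^sup>2 = 1 + \<tau>\<^sup>2"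
      using e i ei unfolding v_def power2_norm_eq_inner
      by (simp add: inner_add_left inner_add_right inner_commute[of i e] norm_eq_1 power2_eq_square)
    then have v0: "v \<noteq> 0" by (metis add_pos_nonneg norm_zero less_irrefl zero_less_one zero_le_power2 zero_power2)
    have "poly p \<tau> = (\<Sum>l\<le>2*j. c l * \<tau> ^ l)"
      by (simp add: p_def poly_sum poly_monom)
    also have "\<dots> = (\<integral>x. (\<Sum>l\<le>2*j. real ((2 * j) choose l) * ((x \<bullet> e) ^ (2 * j - l) * (x \<bullet> i) ^ l) * \<tau> ^ l) \<partial>M)"
      unfolding c_def
      by (subst Bochner_Integration.integral_sum) (auto intro!: integrable_continuous continuous_intros)
    also have "\<dots> = (\<integral>x. (x \<bullet> v) ^ (2 * j) \<partial>M)"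
    proof (intro Bochner_Integration.integral_cong refl)
      fix x :: 'a
      have "(x \<bullet> v) ^ (2 * j) = (\<tau> * (x \<bullet> i) + x \<bullet> e) ^ (2 * j)"
        by (simp add: v_def inner_add_right add.commute)
      then show "(\<Sum>l\<le>2*j. real ((2 * j) choose l) * ((x \<bullet> e) ^ (2 * j - l) * (x \<bullet> i) ^ l) * \<tau> ^ l) = (x \<bullet> v) ^ (2 * j)"
        by (simp only: binomial_ring) (simp add: power_mult_distrib mult_ac)
    qed
    also have "\<dots> = (\<integral>x. norm v ^ (2 * j) * (x \<bullet> (v /\<^sub>R norm v)) ^ (2 * j) \<partial>M)"
      using v0 by (subst power_mult_distrib[symmetric]) (simp add: field_simps)
    also have "\<dots> = norm v ^ (2 * j) * m"
      using moment_unit[of "v /\<^sub>R norm v" e "2 * j"] v0 e by (simp add: m_def)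
    also have "\<dots> = poly q \<tau>"
      unfolding q_def power_mult nv by (simp add: poly_power power2_eq_square)
    finally show ?thesis .
  qed
  then have "p = q" using poly_eq_poly_eq_iff by blast
  then have "coeff p 2 = coeff q 2" by simp
  moreover have "coeff q 2 = real j * m"
  proof -
    have "coeff ([:1, 0, 1:] ^ j) 0 = (1::real) \<and> coeff ([:1, 0, 1:] ^ j) 2 = real j"
      by (induction j) (auto simp: coeff_mult numeral_2_eq_2)
    then show ?thesis by (simp add: q_def)
  qed
  moreover have "coeff p 2 = c 2"
    by (cases "j = 0") (auto simp: p_def coeff_sum c_def)
  ultimately show ?thesis by (simp add: c_def m_def)
qed

text \<open>\<open>mixed_moment\<close> is summed over the other \<open>DIM('a) - 1\<close>
  coordinates; on the unit sphere their squares add up to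
  \<open>1 - (x \<bullet> e)\<^sup>2\<close>.\<close>

lemma moment_recurrence:
  assumes e: "e \<in> Basis" and j: "0 < j"
  shows "(real DIM('a) + 2 * real j - 2) * (\<integral>x. (x \<bullet> e) ^ (2 * j) \<partial>M)
    = (2 * real j - 1) * (\<integral>x. (x \<bullet> e) ^ (2 * j - 2) \<partial>M)"
proof -
  define m where "m k = (\<integral>x. (x \<bullet> e) ^ k \<partial>M)" for k
  have "(\<Sum>i\<in>Basis - {e}. \<integral>x. (x \<bullet> e) ^ (2 * j - 2) * (x \<bullet> i)\<^sup>2 \<partial>M)
      = (\<integral>x. (\<Sum>i\<in>Basis - {e}. (x \<bullet> e) ^ (2 * j - 2) * (x \<bullet> i)\<^sup>2) \<partial>M)"
    by (subst Bochner_Integration.integral_sum) (auto intro!: integrable_continuous continuous_intros)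
  also have "\<dots> = (\<integral>x. (x \<bullet> e) ^ (2 * j - 2) - (x \<bullet> e) ^ (2 * j) \<partial>M)"
  proof (intro integral_cong_AE)
    show "AE x in M. (\<Sum>i\<in>Basis - {e}. (x \<bullet> e) ^ (2 * j - 2) * (x \<bullet> i)\<^sup>2) = (x \<bullet> e) ^ (2 * j - 2) - (x \<bullet> e) ^ (2 * j)"
      using AE_sphere
    proof eventually_elim
      case (elim x)
      have "(\<Sum>i\<in>Basis. (x \<bullet> i)\<^sup>2) = 1"
        using elim euclidean_inner[of x x] by (simp add: norm_eq_1 power2_eq_square)
      then have "(\<Sum>i\<in>Basis - {e}. (x \<bullet> i)\<^sup>2) = 1 - (x \<bullet> e)\<^sup>2"
        using e by (simp add: sum_diff1)
      moreover have "(x \<bullet> e) ^ (2 * j) = (x \<bullet> e) ^ (2 * j - 2) * (x \<bullet> e)\<^sup>2"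
        using j by (cases j) (simp_all add: power2_eq_square)
      ultimately show ?case by (simp flip: sum_distrib_left add: right_diff_distrib)
    qed
  qed (auto simp: measurable_cong_sets[OF sets_M refl])
  also have "\<dots> = m (2 * j - 2) - m (2 * j)"
    unfolding m_def
    by (subst Bochner_Integration.integral_diff) (auto intro!: integrable_continuous continuous_intros)
  finally have *: "(\<Sum>i\<in>Basis - {e}. \<integral>x. (x \<bullet> e) ^ (2 * j - 2) * (x \<bullet> i)\<^sup>2 \<partial>M) = m (2 * j - 2) - m (2 * j)" .
  have ch: "real ((2 * j) choose 2) = real j * (2 * real j - 1)"
  proof -
    have "even (2 * j * (2 * j - 1))" by simp
    then have "real ((2 * j) choose 2) = real (2 * j * (2 * j - 1)) / 2"
      by (simp add: choose_two real_of_nat_div)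
    then show ?thesis using j by (simp add: of_nat_diff)
  qed
  have "real j * (2 * real j - 1) * (\<integral>x. (x \<bullet> e) ^ (2 * j - 2) * (x \<bullet> i)\<^sup>2 \<partial>M) = real j * m (2 * j)"
    if "i \<in> Basis - {e}" for i
    using mixed_moment[of e i j] that e inner_Basis[of e i] unfolding ch m_def by auto
  then have "real j * ((2 * real j - 1) * (\<integral>x. (x \<bullet> e) ^ (2 * j - 2) * (x \<bullet> i)\<^sup>2 \<partial>M)) = real j * m (2 * j)"
    if "i \<in> Basis - {e}" for i using that by (simp add: mult.assoc)
  then have "(\<Sum>i\<in>Basis - {e}. (2 * real j - 1) * (\<integral>x. (x \<bullet> e) ^ (2 * j - 2) * (x \<bullet> i)\<^sup>2 \<partial>M)) = (\<Sum>i\<in>Basis - {e}. m (2 * j))"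
    using j by (intro sum.cong) auto
  then have "(2 * real j - 1) * (m (2 * j - 2) - m (2 * j)) = (real DIM('a) - 1) * m (2 * j)"
    using e * by (simp flip: sum_distrib_left add: card_Diff_singleton of_nat_diff Suc_leI[OF DIM_positive])
  then show ?thesis unfolding m_def[symmetric] by (simp add: algebra_simps)
qed

end

text \<open>The moments of the conjectured law of a coordinate, before division by the total mass
  \<open>cos_moment N 0\<close>.\<close>

definition cos_moment :: "nat \<Rightarrow> nat \<Rightarrow> real" where
  "cos_moment N k = integral {-(pi/2)..pi/2} (\<lambda>\<theta>. sin \<theta> ^ k * cos \<theta> ^ N)"

lemma cos_moment_odd: "cos_moment N k = 0" if "odd k"
proof -
  have "cos_moment N k = integral {-(pi/2)..-(-(pi/2))} (\<lambda>\<theta>. sin (-\<theta>) ^ k * cos (-\<theta>) ^ N)"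
    unfolding cos_moment_def 
    using Henstock_Kurzweil_Integration.integral_reflect_real[of "pi/2" "-(pi/2)" "\<lambda>\<theta>. sin (-\<theta>) ^ k * cos (-\<theta>) ^ N"] that
    by (simp add: power_minus_odd)
  then show ?thesis using that by (simp add: cos_moment_def power_minus_odd)
qed

text \<open>The function \<open>F\<close>, equal to
  \<open>sin \<theta> ^ (2 * j - 1) * cos \<theta> ^ (N + 1)\<close>, vanishes at both endpoints, so
  its derivative integrates to 0. For \<open>N = DIM('a) - 2\<close> the coefficients are those of
  \<open>moment_recurrence\<close>.\<close>

lemma cos_moment_recurrence:
  assumes "0 < j"
  shows "(real N + 2 * real j) * cos_moment N (2 * j) = (2 * real j - 1) * cos_moment N (2 * j - 2)"
proof -
  obtain i where i: "j = Suc i" using assms gr0_conv_Suc by blast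
  define F where "F \<theta> = sin \<theta> ^ (2 * i + 1) * cos \<theta> ^ (N + 1)" for \<theta> :: real
  define f where "f \<theta> = (2 * real j - 1) * (sin \<theta> ^ (2 * i) * cos \<theta> ^ N) - (real N + 2 * real j) * (sin \<theta> ^ (2 * j) * cos \<theta> ^ N)" for \<theta> :: real
  have "(F has_real_derivative f \<theta>) (at \<theta>)" for \<theta>
  proof -
    have "(F has_real_derivative (2 * real i + 1) * sin \<theta> ^ (2 * i) * cos \<theta> * cos \<theta> ^ (N + 1)
       - (real N + 1) * cos \<theta> ^ N * sin \<theta> * sin \<theta> ^ (2 * i + 1)) (at \<theta>)"
      unfolding F_def by (rule derivative_eq_intros refl)+ (simp add: algebra_simps del: power_Suc)
    moreover have "(2 * real i + 1) * sin \<theta> ^ (2 * i) * cos \<theta> * cos \<theta> ^ (N + 1) - (real N + 1) * cos \<theta> ^ N * sin \<theta> * sin \<theta> ^ (2 * i + 1)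
      = (2 * real i + 1) * (sin \<theta> ^ (2 * i) * cos \<theta> ^ N) * (cos \<theta>)\<^sup>2 - (real N + 1) * (sin \<theta> ^ (2 * i) * cos \<theta> ^ N) * (sin \<theta>)\<^sup>2"
      by (simp add: power2_eq_square)
    moreover have "\<dots> = f \<theta>"
      unfolding f_def i cos_squared_eq by (simp add: power2_eq_square algebra_simps)
    ultimately show ?thesis by simp
  qed
  then have "(f has_integral F (pi/2) - F (-(pi/2))) {-(pi/2)..pi/2}"
    by (intro fundamental_theorem_of_calculus)
      (auto simp: has_field_derivative_at_within simp flip: has_real_derivative_iff_has_vector_derivative)
  then have "integral {-(pi/2)..pi/2} f = 0" by (simp add: F_def integral_unique)
  moreover have "integral {-(pi/2)..pi/2} f = (2 * real j - 1) * cos_moment N (2 * i) - (real N + 2 * real j) * cos_moment N (2 * j)"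
    unfolding f_def cos_moment_def
    by (subst integral_diff) (auto intro!: integrable_continuous_interval continuous_intros)
  ultimately show ?thesis by (simp add: i)
qed

lemma cos_moment_0: "cos_moment N 0 = 2 * integral {0..pi/2} (\<lambda>\<theta>. cos \<theta> ^ N)"
proof -
  have int: "(\<lambda>\<theta>::real. cos \<theta> ^ N) integrable_on {a..b}" for a b
    by (intro integrable_continuous_interval continuous_intros)
  have "cos_moment N 0 = integral {-(pi/2)..0} (\<lambda>\<theta>. cos \<theta> ^ N) + integral {0..pi/2} (\<lambda>\<theta>. cos \<theta> ^ N)"
    unfolding cos_moment_def
    using Henstock_Kurzweil_Integration.integral_combine[of "-(pi/2)" 0 "pi/2" "\<lambda>\<theta>. cos \<theta> ^ N"] int by simp
  also have "integral {-(pi/2)..0} (\<lambda>\<theta>. cos \<theta> ^ N) = integral {0..pi/2} (\<lambda>\<theta>. cos \<theta> ^ N)"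
    using Henstock_Kurzweil_Integration.integral_reflect_real[of "pi/2" 0 "\<lambda>\<theta>. cos \<theta> ^ N"] by simp
  finally show ?thesis by simp
qed

section \<open>Identification of the law of a coordinate\<close>

context invariant_sphere_prob
begin

text \<open>Both sides are 1 for \<open>k = 0\<close>, vanish for odd \<open>k\<close> and satisfy
  the same recurrence for even \<open>k\<close>.\<close>

lemma moment_eq:
  assumes e: "e \<in> Basis" and n: "2 \<le> DIM('a)"
  shows "(\<integral>x. (x \<bullet> e) ^ k \<partial>M) = cos_moment (DIM('a) - 2) k / cos_moment (DIM('a) - 2) 0"
proof -
  have Z: "cos_moment (DIM('a) - 2) 0 > 0"
    unfolding cos_moment_0 using integral_cos_power_pos by simp
  have even: "(\<integral>x. (x \<bullet> e) ^ (2 * j) \<partial>M) = cos_moment (DIM('a) - 2) (2 * j) / cos_moment (DIM('a) - 2) 0" for j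
  proof (induction j)
    case 0
    then show ?case using Z prob_space by simp
  next
    case (Suc j)
    have nn: "real (DIM('a) - 2) = real DIM('a) - 2" using n by simp
    have p: "real DIM('a) + 2 * real (Suc j) - 2 > 0" using n by simp
    have "(real DIM('a) + 2 * real (Suc j) - 2) * (\<integral>x. (x \<bullet> e) ^ (2 * Suc j) \<partial>M)
      = (2 * real (Suc j) - 1) * (cos_moment (DIM('a) - 2) (2 * j) / cos_moment (DIM('a) - 2) 0)"
      using moment_recurrence[OF e, of "Suc j"] Suc by simp
    also have "\<dots> = (real DIM('a) + 2 * real (Suc j) - 2) * (cos_moment (DIM('a) - 2) (2 * Suc j) / cos_moment (DIM('a) - 2) 0)"
      using cos_moment_recurrence[of "Suc j" "DIM('a) - 2"] unfolding nn
      by (simp add: field_simps)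
    finally show ?case using p by (subst (asm) mult_left_cancel) auto
  qed
  show ?thesis
  proof (cases "even k")
    case True
    then show ?thesis using even by auto
  next
    case False
    then show ?thesis by (simp add: moment_odd cos_moment_odd)
  qed
qed

text \<open>Equality of moments gives the identity for polynomials. A uniform polynomial
  approximation on \<open>{-1..1}\<close> within \<open>\<epsilon>\<close> changes each side by at
  most \<open>\<epsilon>\<close>.\<close>

lemma integral_coordinate:
  fixes f :: "real \<Rightarrow> real"
  assumes e: "e \<in> Basis" and n: "2 \<le> DIM('a)" and f: "continuous_on UNIV f"
  shows "(\<integral>x. f (x \<bullet> e) \<partial>M)
    = integral {-(pi/2)..pi/2} (\<lambda>\<theta>. f (sin \<theta>) * cos \<theta> ^ (DIM('a) - 2)) / cos_moment (DIM('a) - 2) 0"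
proof -
  define N where "N = DIM('a) - 2"
  define Z where "Z = cos_moment N 0"
  define E where "E g = (\<integral>x. g (x \<bullet> e) \<partial>M)" for g :: "real \<Rightarrow> real"
  define R where "R g = integral {-(pi/2)..pi/2} (\<lambda>\<theta>. g (sin \<theta>) * cos \<theta> ^ N)" for g :: "real \<Rightarrow> real"
  have Z: "Z > 0"
    unfolding Z_def cos_moment_0 using integral_cos_power_pos by simp
  have fc [continuous_intros]: "continuous_on S (\<lambda>x. f (h x))" if "continuous_on S h" for S and h :: "'b::topological_space \<Rightarrow> real"
    using continuous_on_compose2[OF f that] by simp
  have close: "\<bar>E f - R f / Z\<bar> \<le> 2 * \<epsilon>" if \<epsilon>: "\<epsilon> > 0" for \<epsilon>
  proof -
    obtain g where g: "real_polynomial_function g" "\<And>x. x \<in> {-1..1} \<Longrightarrow> \<bar>f x - g x\<bar> < \<epsilon>"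
      using Stone_Weierstrass_real_polynomial_function[of "{-1..1::real}" f \<epsilon>] \<epsilon> continuous_on_subset[OF f] by auto
    obtain a d where a: "g = (\<lambda>x. \<Sum>i\<le>d. a i * x ^ i)"
      using g(1) real_polynomial_function_iff_sum by auto
    have gc [continuous_intros]: "continuous_on S (\<lambda>x. g (h x))" if "continuous_on S h" for S and h :: "'b::topological_space \<Rightarrow> real"
      unfolding a using that by (intro continuous_intros)
    have "E g = (\<Sum>i\<le>d. a i * (\<integral>x. (x \<bullet> e) ^ i \<partial>M))"
      unfolding E_def a
      by (subst Bochner_Integration.integral_sum) (auto intro!: integrable_continuous continuous_intros)
    also have "\<dots> = (\<Sum>i\<le>d. a i * (cos_moment N i / Z))"
      by (simp add: moment_eq[OF e n] N_def Z_def)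
    also have "\<dots> = (\<Sum>i\<le>d. integral {-(pi/2)..pi/2} (\<lambda>\<theta>. a i * (sin \<theta> ^ i * cos \<theta> ^ N))) / Z"
      by (simp add: cos_moment_def sum_divide_distrib)
    also have "\<dots> = R g / Z"
      unfolding R_def a sum_distrib_right mult.assoc
      by (subst integral_sum) (auto intro!: integrable_continuous_interval continuous_intros)
    finally have Eg: "E g = R g / Z" .
    have "\<bar>E f - E g\<bar> \<le> \<epsilon>"
    proof -
      have ifg: "integrable M (\<lambda>x. f (x \<bullet> e))" "integrable M (\<lambda>x. g (x \<bullet> e))"
        by (auto intro!: integrable_continuous continuous_intros)
      have "AE x in M. \<bar>f (x \<bullet> e) - g (x \<bullet> e)\<bar> \<le> \<epsilon>"
        using AE_sphere
      proof eventually_elim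
        case (elim x)
        have "\<bar>x \<bullet> e\<bar> \<le> 1" using Cauchy_Schwarz_ineq2[of x e] elim e by simp
        then show ?case using g(2)[of "x \<bullet> e"] by (auto simp: abs_le_iff less_imp_le)
      qed
      then have "(\<integral>x. \<bar>f (x \<bullet> e) - g (x \<bullet> e)\<bar> \<partial>M) \<le> (\<integral>x. \<epsilon> \<partial>M)"
        using ifg by (intro integral_mono_AE) auto
      moreover have "\<bar>E f - E g\<bar> \<le> (\<integral>x. \<bar>f (x \<bullet> e) - g (x \<bullet> e)\<bar> \<partial>M)"
        unfolding E_def using ifg integral_abs_bound[of M "\<lambda>x. f (x \<bullet> e) - g (x \<bullet> e)"] by simp
      ultimately show ?thesis using prob_space by simp
    qed
    moreover have "\<bar>R f - R g\<bar> \<le> \<epsilon> * Z"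
    proof -
      have "R f - R g = integral {-(pi/2)..pi/2} (\<lambda>\<theta>. (f (sin \<theta>) - g (sin \<theta>)) * cos \<theta> ^ N)"
        unfolding R_def
        by (subst integral_diff[symmetric]) (auto intro!: integrable_continuous_interval continuous_intros simp: algebra_simps)
      \<comment> \<open>The factor \<open>sin \<theta> ^ 0\<close> is kept so that the bound is
        literally a multiple of \<open>cos_moment N 0\<close>.\<close>
      moreover have "norm \<dots> \<le> integral {-(pi/2)..pi/2} (\<lambda>\<theta>. \<epsilon> * (sin \<theta> ^ 0 * cos \<theta> ^ N))"
      proof (rule integral_norm_bound_integral)
        fix \<theta> :: real assume "\<theta> \<in> {-(pi/2)..pi/2}"
        then have "0 \<le> cos \<theta> ^ N" by (intro zero_le_power cos_ge_zero) auto
        moreover have "\<bar>f (sin \<theta>) - g (sin \<theta>)\<bar> \<le> \<epsilon>" using g(2)[of "sin \<theta>"] by auto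
        ultimately show "norm ((f (sin \<theta>) - g (sin \<theta>)) * cos \<theta> ^ N) \<le> \<epsilon> * (sin \<theta> ^ 0 * cos \<theta> ^ N)"
          by (auto simp: abs_mult intro: mult_right_mono)
      qed (auto intro!: integrable_continuous_interval continuous_intros)
      moreover have "integral {-(pi/2)..pi/2} (\<lambda>\<theta>. \<epsilon> * (sin \<theta> ^ 0 * cos \<theta> ^ N)) = \<epsilon> * Z"
        by (simp only: Z_def cos_moment_def integral_mult_right)
      ultimately show ?thesis by (simp only: real_norm_def)
    qed
    then have "\<bar>R f / Z - R g / Z\<bar> \<le> \<epsilon>"
      using Z by (simp add: diff_divide_distrib[symmetric] abs_divide pos_divide_le_eq)
    ultimately show ?thesis using Eg by linarith
  qed
  have "\<bar>E f - R f / Z\<bar> \<le> 0"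
  proof (rule field_le_epsilon)
    fix \<epsilon> :: real assume "\<epsilon> > 0"
    then show "\<bar>E f - R f / Z\<bar> \<le> 0 + \<epsilon>" using close[of "\<epsilon>/2"] by simp
  qed
  then show ?thesis by (simp add: E_def R_def N_def Z_def)
qed

text \<open>The coordinate law is available for continuous functions only, so the indicator of the
  cap is dominated by the ramp \<open>f\<close> rising from 0 at \<open>sin s\<close> to 1 at
  \<open>sin t\<close>. The gap between \<open>s\<close> and \<open>t\<close> is closed later by a
  limit.\<close>

lemma cap_measure_le:
  assumes e: "e \<in> Basis" and n: "2 < DIM('a)" and s: "0 \<le> s" "s < t" "t \<le> pi/2"
  shows "measure M {x. sin t \<le> x \<bullet> e} \<le> 1/2 * exp (- (real DIM('a) * s\<^sup>2 / 2))"
proof -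
  define N where "N = DIM('a) - 2"
  define Z where "Z = integral {0..pi/2} (\<lambda>\<theta>. cos \<theta> ^ N)"
  have Z: "Z > 0" unfolding Z_def by (rule integral_cos_power_pos)
  have st: "sin s < sin t" using s by (intro sin_monotone_2pi) auto
  define f where "f r = max 0 (min 1 ((r - sin s) / (sin t - sin s)))" for r :: real
  have fc [continuous_intros]: "continuous_on S (\<lambda>x. f (h x))" if "continuous_on S h" for S and h :: "'b::topological_space \<Rightarrow> real"
    unfolding f_def using that st by (intro continuous_intros) auto
  have f01: "0 \<le> f r" "f r \<le> 1" for r by (auto simp: f_def)
  have f0: "f r = 0" if "r \<le> sin s" for r
    using that st by (auto simp: f_def divide_le_0_iff)
  have f1: "f r = 1" if "sin t \<le> r" for r
    using that st by (auto simp: f_def min_def le_divide_eq)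
  have "integral {-(pi/2)..pi/2} (\<lambda>\<theta>. f (sin \<theta>) * cos \<theta> ^ N)
      = integral {-(pi/2)..s} (\<lambda>\<theta>. f (sin \<theta>) * cos \<theta> ^ N) + integral {s..pi/2} (\<lambda>\<theta>. f (sin \<theta>) * cos \<theta> ^ N)"
    by (rule Henstock_Kurzweil_Integration.integral_combine[symmetric])
      (use s in \<open>auto intro!: integrable_continuous_interval continuous_intros\<close>)
  also have "integral {-(pi/2)..s} (\<lambda>\<theta>. f (sin \<theta>) * cos \<theta> ^ N) = integral {-(pi/2)..s} (\<lambda>\<theta>. 0)"
    by (intro Henstock_Kurzweil_Integration.integral_cong) (use s in \<open>auto intro!: f0 sin_monotone_2pi_le\<close>)
  also have "integral {s..pi/2} (\<lambda>\<theta>. f (sin \<theta>) * cos \<theta> ^ N) \<le> integral {s..pi/2} (\<lambda>\<theta>. cos \<theta> ^ N)"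
    by (intro integral_le integrable_continuous_interval continuous_intros)
      (use s f01 in \<open>auto intro!: mult_left_le_one_le zero_le_power[OF cos_ge_zero]\<close>)
  also have "\<dots> \<le> exp (- (real (N + 2) * s\<^sup>2 / 2)) * Z"
    unfolding Z_def by (intro integral_cos_power_tail) (use s n in \<open>auto simp: N_def\<close>)
  finally have I: "integral {-(pi/2)..pi/2} (\<lambda>\<theta>. f (sin \<theta>) * cos \<theta> ^ N) \<le> exp (- (real (N + 2) * s\<^sup>2 / 2)) * Z"
    by simp
  have "measure M {x. sin t \<le> x \<bullet> e} = (\<integral>x. indicator {x. sin t \<le> x \<bullet> e} x \<partial>M)"
    by simp
  also have "\<dots> \<le> (\<integral>x. f (x \<bullet> e) \<partial>M)"
  proof (rule integral_mono)
    show "integrable M (\<lambda>x. indicator {x. sin t \<le> x \<bullet> e} x :: real)"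
      by (rule integrable_real_indicator) (auto simp: less_top[symmetric])
  qed (auto intro!: integrable_continuous continuous_intros simp: indicator_def f01 f1)
  also have "\<dots> = integral {-(pi/2)..pi/2} (\<lambda>\<theta>. f (sin \<theta>) * cos \<theta> ^ N) / (2 * Z)"
    using integral_coordinate[OF e _ fc[OF continuous_on_id]] n by (simp add: N_def Z_def cos_moment_0)
  also have "\<dots> \<le> exp (- (real (N + 2) * s\<^sup>2 / 2)) * Z / (2 * Z)"
    using I Z by (intro divide_right_mono) auto
  also have "real (N + 2) = real DIM('a)" using n by (simp add: N_def)
  finally show ?thesis using Z by simp
qed

end

subsection \<open>Random reflections\<close>

lemma dist_reflect: "dist (reflect u x) (reflect u y) = dist x y"
  using orthogonal_transformation_reflect[of u] by (simp add: orthogonal_transformation_isometry)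

text \<open>For unit \<open>u\<close> the map is
  \<open>x - (2 * (x \<bullet> u)) *\<^sub>R u\<close>; each of the two occurrences of
  \<open>u\<close> contributes 2 to the constant.\<close>

lemma reflect_lipschitz:
  assumes "norm u = 1" "norm v = 1" "norm x = 1"
  shows "dist (reflect u x) (reflect v x) \<le> 4 * dist u v"
proof -
  have "reflect u x - reflect v x = - (2 *\<^sub>R ((x \<bullet> (u - v)) *\<^sub>R u + (x \<bullet> v) *\<^sub>R (u - v)))"
    using assms by (simp add: reflect_def norm_eq_1 inner_diff_right algebra_simps)
  then have "dist (reflect u x) (reflect v x) = 2 * norm ((x \<bullet> (u - v)) *\<^sub>R u + (x \<bullet> v) *\<^sub>R (u - v))"
    by (simp add: dist_norm)
  also have "norm ((x \<bullet> (u - v)) *\<^sub>R u + (x \<bullet> v) *\<^sub>R (u - v)) \<le> \<bar>x \<bullet> (u - v)\<bar> + \<bar>x \<bullet> v\<bar> * norm (u - v)"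
    by (rule order_trans[OF norm_triangle_ineq]) (simp add: assms)
  also have "\<dots> \<le> norm (u - v) + 1 * norm (u - v)"
    using Cauchy_Schwarz_ineq2[of x "u - v"] Cauchy_Schwarz_ineq2[of x v] assms
    by (intro add_mono mult_right_mono) auto
  finally show ?thesis by (simp add: dist_norm)
qed

text \<open>The balls of radius \<open>r/2\<close> around the points are disjoint and lie in
  \<open>ball e (5 * r)\<close>; comparing volumes gives the base
  \<open>10 = 5 / (1/2)\<close>.\<close>

lemma card_separated_le:
  fixes F :: "'a :: euclidean_space set"
  assumes F: "finite F" "F \<subseteq> ball e (4 * r)" and r: "0 < r"
    and sep: "\<And>x y. x \<in> F \<Longrightarrow> y \<in> F \<Longrightarrow> x \<noteq> y \<Longrightarrow> r \<le> dist x y"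
  shows "card F \<le> 10 ^ DIM('a)"
proof -
  define V where "V = unit_ball_vol (real DIM('a)) * (r/2) ^ DIM('a)"
  have V: "V > 0" using r by (simp add: V_def)
  have "disjoint_family_on (\<lambda>x. ball x (r/2)) F"
  proof (unfold disjoint_family_on_def, intro ballI impI)
    fix x y assume "x \<in> F" "y \<in> F" "x \<noteq> y"
    then show "ball x (r/2) \<inter> ball y (r/2) = {}"
      using sep[of x y] by (intro disjoint_ballI) simp
  qed
  then have "measure lborel (\<Union>x\<in>F. ball x (r/2)) = (\<Sum>x\<in>F. measure lborel (ball x (r/2)))"
    using F emeasure_lborel_ball_finite by (intro measure_finite_Union) (auto simp: less_top[symmetric])
  also have "\<dots> = real (card F) * V"
    using r by (simp add: content_ball V_def)
  finally have "real (card F) * V = measure lborel (\<Union>x\<in>F. ball x (r/2))" by simp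
  also have "\<dots> \<le> measure lborel (ball e (5 * r))"
  proof (rule measure_mono_fmeasurable)
    show "(\<Union>x\<in>F. ball x (r/2)) \<subseteq> ball e (5 * r)"
    proof safe
      fix x z assume "x \<in> F" "z \<in> ball x (r/2)"
      then have "dist e x < 4 * r" "dist x z < r/2" using F by auto
      then show "z \<in> ball e (5 * r)" using dist_triangle[of e z x] r by simp
    qed
  qed (use emeasure_lborel_ball_finite[of e "5 * r"] in \<open>auto simp: fmeasurable_def intro!: borel_open\<close>)
  also have "\<dots> = 10 ^ DIM('a) * V"
  proof -
    have "(5 * r) ^ DIM('a) = (10 * (r/2)) ^ DIM('a)" by simp
    also have "\<dots> = 10 ^ DIM('a) * (r/2) ^ DIM('a)" by (rule power_mult_distrib)
    finally show ?thesis
      using content_ball[of "5 * r" e] r unfolding V_def by (simp only: mult_ac)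
  qed
  finally have "real (card F) \<le> real (10 ^ DIM('a))" using V by simp
  then show ?thesis by (simp only: of_nat_le_iff)
qed

section \<open>Measures of balls and the law of a random reflection\<close>

context invariant_sphere_prob
begin

lemma sphere_measure: "measure M (sphere 0 1) = 1"
  using AE_sphere by (subst prob_eq_1) auto

lemma measure_Int_sphere:
  assumes "A \<in> sets borel"
  shows "measure M (A \<inter> sphere 0 1) = measure M A"
  using AE_sphere assms by (intro finite_measure_eq_AE) auto

text \<open>A reflection exchanges the centres.\<close>

lemma measure_ball_eq:
  assumes "norm x = 1" "norm y = 1"
  shows "measure M (ball x r) = measure M (ball y r)"
proof -
  have "{z. reflect (x - y) z \<in> ball y r} = ball x r"
    using dist_reflect[of "x - y" x] reflect_swap[of x y] assms by auto
  then show ?thesis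
    using measure_orthogonal[OF orthogonal_transformation_reflect, of "ball y r" "x - y"] by simp
qed

text \<open>Otherwise all balls of this radius centred on the sphere are null, and by compactness
  finitely many of them cover it.\<close>

lemma measure_ball_pos:
  assumes x: "norm x = 1" and r: "0 < r"
  shows "0 < measure M (ball x r)"
proof (rule ccontr)
  assume "\<not> 0 < measure M (ball x r)"
  then have 0: "measure M (ball y r) = 0" if "norm y = 1" for y
    using measure_ball_eq[OF x that, of r] measure_nonneg[of M "ball x r"] by linarith
  have "sphere 0 1 \<subseteq> (\<Union>y\<in>sphere (0::'a) 1. ball y r)" using r by auto
  then obtain D where D: "D \<subseteq> sphere (0::'a) 1" "finite D" "sphere 0 1 \<subseteq> (\<Union>y\<in>D. ball y r)"
    by (rule compactE_image[OF compact_sphere open_ball])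
  have "measure M (sphere 0 1) \<le> measure M (\<Union>y\<in>D. ball y r)"
    using D by (intro finite_measure_mono) auto
  also have "\<dots> \<le> (\<Sum>y\<in>D. measure M (ball y r))"
    using D by (intro finite_measure_subadditive_finite) auto
  also have "\<dots> = 0" using D 0 by (intro sum.neutral) auto
  finally show False by (simp add: sphere_measure)
qed

text \<open>A largest \<open>r\<close>-separated subset of the big ball within the sphere exists by
  \<open>card_separated_le\<close>; its maximality makes the \<open>r\<close>-balls around its
  points a cover, and these all have the same measure.\<close>

lemma measure_ball_doubling:
  assumes e: "norm e = 1" and r: "0 < r"
  shows "measure M (ball e (4 * r)) \<le> 10 ^ DIM('a) * measure M (ball e r)"
proof -
  define P where "P F \<longleftrightarrow> finite F \<and> F \<subseteq> ball e (4 * r) \<inter> sphere 0 1 \<and>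
    (\<forall>x\<in>F. \<forall>y\<in>F. x \<noteq> y \<longrightarrow> r \<le> dist x y)" for F
  have card: "card F \<le> 10 ^ DIM('a)" if "P F" for F
    using that r by (intro card_separated_le[of F e r]) (auto simp: P_def)
  then obtain F where F: "P F" "\<And>G. P G \<Longrightarrow> card G \<le> card F"
    using ex_has_greatest_nat[of P "{}" card "Suc (10 ^ DIM('a))"] by (force simp: P_def less_Suc_eq_le)
  have cover: "ball e (4 * r) \<inter> sphere 0 1 \<subseteq> (\<Union>f\<in>F. ball f r)"
  proof (rule ccontr)
    assume "\<not> ?thesis"
    then obtain z where z: "z \<in> ball e (4 * r) \<inter> sphere 0 1" "z \<notin> (\<Union>f\<in>F. ball f r)"
      by blast
    then have sep: "r \<le> dist f z" if "f \<in> F" for f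
      using that by (auto simp: not_less)
    then have "P (insert z F)" using F(1) z(1) by (auto simp: P_def dist_commute)
    moreover have "z \<notin> F" using sep[of z] r by auto
    ultimately show False using F(2)[of "insert z F"] F(1) by (simp add: P_def)
  qed
  have "measure M (ball e (4 * r)) = measure M (ball e (4 * r) \<inter> sphere 0 1)"
    by (simp add: measure_Int_sphere)
  also have "\<dots> \<le> measure M (\<Union>f\<in>F. ball f r)"
    using F(1) by (intro finite_measure_mono cover) (auto simp: P_def)
  also have "\<dots> \<le> (\<Sum>f\<in>F. measure M (ball f r))"
    using F(1) by (intro finite_measure_subadditive_finite) (auto simp: P_def)
  also have "\<dots> = (\<Sum>f\<in>F. measure M (ball e r))"
    using F(1) e by (intro sum.cong refl measure_ball_eq) (auto simp: P_def)
  also have "\<dots> = real (card F) * measure M (ball e r)" by simp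
  also have "\<dots> \<le> real (10 ^ DIM('a)) * measure M (ball e r)"
    using card[OF F(1)] by (intro mult_right_mono) (simp_all only: of_nat_le_iff measure_nonneg)
  finally show ?thesis by simp
qed

text \<open>
  The inverse of $u \mapsto s_u x$ is $y \mapsto T y = (x - y) / |x - y|$. Integrating the indicator
  of $|T y - u| < \varepsilon$ over $y \in Q$ and over $u$, in both orders, compares the measure of
  \<open>Q\<close> with the law of $s_u x$ on the $4\varepsilon$-neighbourhood of \<open>Q\<close>.
\<close>

lemma reflect_law_nbhd:
  assumes x: "norm x = 1" and Q: "Q \<in> sets borel" "Q \<subseteq> sphere 0 1" "x \<notin> Q" and \<epsilon>: "0 < \<epsilon>"
  shows "measure M Q \<le> 10 ^ DIM('a) * measure M {u. reflect u x \<in> (\<Union>y\<in>Q. ball y (4 * \<epsilon>))}"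
proof -
  interpret pair_sigma_finite M M ..
  note Q(1)[measurable]
  define U where "U = (\<Union>y\<in>Q. ball y (4 * \<epsilon>))"
  have U[measurable]: "U \<in> sets borel" by (auto simp: U_def intro!: borel_open)
  define T where "T y = (x - y) /\<^sub>R norm (x - y)" for y
  have T[measurable]: "T \<in> borel_measurable borel" unfolding T_def by measurable
  have nT: "norm (T y) = 1" if "y \<in> Q" for y using that Q(3) by (cases "x = y") (auto simp: T_def)
  have rT: "reflect (T y) x = y" if "y \<in> Q" for y
  proof -
    have "reflect (T y) x = reflect (x - y) x"
    proof -
      have "x \<noteq> y" using that Q(3) by auto
      then show ?thesis
        by (simp add: T_def reflect_def power2_norm_eq_inner[symmetric] power2_eq_square divide_inverse)
    qed
    then show ?thesis using reflect_swap[of x y] x that Q(2) by auto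
  qed
  define g :: "'a \<Rightarrow> 'a \<Rightarrow> ennreal" where "g y u = indicator Q y * indicator {p. dist (fst p) (snd p) < \<epsilon>} (T y, u)" for y u
  have o: "open {p :: 'a \<times> 'a. dist (fst p) (snd p) < \<epsilon>}"
    by (intro open_Collect_less continuous_intros)
  have [measurable]: "{p :: 'a \<times> 'a. dist (fst p) (snd p) < \<epsilon>} \<in> sets (borel \<Otimes>\<^sub>M borel)"
    unfolding borel_prod by (rule borel_open[OF o])
  have gm: "case_prod g \<in> borel_measurable (M \<Otimes>\<^sub>M M)"
    unfolding g_def by measurable
  define c where "c r = measure M (ball x r)" for r
  have "(\<integral>\<^sup>+y. \<integral>\<^sup>+u. g y u \<partial>M \<partial>M) = (\<integral>\<^sup>+y. ennreal (c \<epsilon>) * indicator Q y \<partial>M)"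
  proof (intro nn_integral_cong)
    fix y
    show "(\<integral>\<^sup>+u. g y u \<partial>M) = ennreal (c \<epsilon>) * indicator Q y"
    proof (cases "y \<in> Q")
      case True
      then have "(\<integral>\<^sup>+u. g y u \<partial>M) = (\<integral>\<^sup>+u. indicator (ball (T y) \<epsilon>) u \<partial>M)"
        by (intro nn_integral_cong) (auto simp: g_def indicator_def)
      also have "\<dots> = ennreal (c \<epsilon>)"
        using measure_ball_eq[OF nT[OF True] x] by (simp add: emeasure_eq_measure c_def)
      finally show ?thesis using True by simp
    qed (simp add: g_def)
  qed
  also have "\<dots> = ennreal (c \<epsilon> * measure M Q)"
    using Q(1) by (simp add: nn_integral_cmult_indicator emeasure_eq_measure ennreal_mult c_def)
  finally have L: "(\<integral>\<^sup>+y. \<integral>\<^sup>+u. g y u \<partial>M \<partial>M) = ennreal (c \<epsilon> * measure M Q)" .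
  have Um: "{u. reflect u x \<in> U} \<in> sets borel"
    by measurable
  have "(\<integral>\<^sup>+y. \<integral>\<^sup>+u. g y u \<partial>M \<partial>M) = (\<integral>\<^sup>+u. \<integral>\<^sup>+y. g y u \<partial>M \<partial>M)"
    using Fubini'[OF gm] by simp
  also have "\<dots> \<le> (\<integral>\<^sup>+u. ennreal (c (4 * \<epsilon>)) * indicator {u. reflect u x \<in> U} u \<partial>M)"
  proof (rule nn_integral_mono_AE)
    show "AE u in M. (\<integral>\<^sup>+y. g y u \<partial>M) \<le> ennreal (c (4 * \<epsilon>)) * indicator {u. reflect u x \<in> U} u"
      using AE_sphere
    proof eventually_elim
      case (elim u)
      \<comment> \<open>If \<open>T y\<close> is within \<open>\<epsilon>\<close> of
        \<open>u\<close>, then by \<open>reflect_lipschitz\<close> the point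
        \<open>reflect u x\<close> is within \<open>4 * \<epsilon>\<close> of
        \<open>reflect (T y) x = y\<close>.\<close>
      have "g y u \<le> indicator {u. reflect u x \<in> U} u * indicator (ball (reflect u x) (4 * \<epsilon>)) y" for y
      proof (cases "y \<in> Q \<and> dist (T y) u < \<epsilon>")
        case True
        then have "dist (reflect u x) y < 4 * \<epsilon>"
          using reflect_lipschitz[OF elim nT x, of y] rT[of y] by (simp add: dist_commute)
        then show ?thesis using True by (auto simp: g_def U_def indicator_def dist_commute)
      qed (auto simp: g_def)
      then have "(\<integral>\<^sup>+y. g y u \<partial>M) \<le> (\<integral>\<^sup>+y. indicator {u. reflect u x \<in> U} u * indicator (ball (reflect u x) (4 * \<epsilon>)) y \<partial>M)"
        by (intro nn_integral_mono)
      also have "\<dots> = indicator {u. reflect u x \<in> U} u * ennreal (c (4 * \<epsilon>))"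
        using measure_ball_eq[of "reflect u x" x] x
        by (simp add: nn_integral_cmult_indicator emeasure_eq_measure c_def)
      finally show ?case by (simp add: mult.commute)
    qed
  qed
  also have "\<dots> = ennreal (c (4 * \<epsilon>) * measure M {u. reflect u x \<in> U})"
    using Um by (simp add: nn_integral_cmult_indicator emeasure_eq_measure ennreal_mult c_def)
  finally have "c \<epsilon> * measure M Q \<le> c (4 * \<epsilon>) * measure M {u. reflect u x \<in> U}"
    unfolding L by (simp add: c_def)
  also have "\<dots> \<le> (10 ^ DIM('a) * c \<epsilon>) * measure M {u. reflect u x \<in> U}"
    using measure_ball_doubling[OF x \<epsilon>] by (intro mult_right_mono) (auto simp: c_def)
  finally have "c \<epsilon> * measure M Q \<le> c \<epsilon> * (10 ^ DIM('a) * measure M {u. reflect u x \<in> U})"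
    by (simp add: mult_ac)
  then show ?thesis using measure_ball_pos[OF x \<epsilon>] by (simp add: c_def U_def)
qed

text \<open>As \<open>\<epsilon>\<close> tends to 0, the neighbourhoods of a closed set shrink to
  the set itself, and \<open>M\<close> is continuous from above.\<close>

lemma reflect_law_closed:
  assumes x: "norm x = 1" and Q: "closed Q" "Q \<subseteq> sphere 0 1" "x \<notin> Q"
  shows "measure M Q \<le> 10 ^ DIM('a) * measure M {u. reflect u x \<in> Q}"
proof -
  define U where "U k = {u. reflect u x \<in> (\<Union>y\<in>Q. ball y (4 * (1 / real (Suc k))))}" for k
  have U: "U k \<in> sets M" for k
  proof -
    have [measurable]: "(\<Union>y\<in>Q. ball y (4 * (1 / real (Suc k)))) \<in> sets borel"
      by (auto intro!: borel_open)
    show ?thesis unfolding U_def by measurable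
  qed
  have "decseq U"
  proof (rule decseq_SucI)
    fix k
    have "4 * (1 / real (Suc (Suc k))) \<le> 4 * (1 / real (Suc k))" by (simp add: frac_le)
    then show "U (Suc k) \<subseteq> U k" unfolding U_def by fastforce
  qed
  then have "(\<lambda>k. measure M (U k)) \<longlonglongrightarrow> measure M (\<Inter>k. U k)"
    using U by (intro finite_Lim_measure_decseq) auto
  moreover have "(\<Inter>k. U k) \<subseteq> {u. reflect u x \<in> Q}"
  proof safe
    fix u assume u: "u \<in> (\<Inter>k. U k)"
    have "reflect u x \<in> closure Q"
      unfolding closure_approachable
    proof (intro allI impI)
      fix \<epsilon> :: real assume "0 < \<epsilon>"
      then obtain k where k: "1 / real (Suc k) < \<epsilon> / 4" using nat_approx_posE[of "\<epsilon>/4"] by auto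
      have "u \<in> U k" using u by auto
      then obtain y where "y \<in> Q" "dist y (reflect u x) < 4 * (1 / real (Suc k))" by (auto simp: U_def)
      then show "\<exists>y\<in>Q. dist y (reflect u x) < \<epsilon>" using k by force
    qed
    then show "reflect u x \<in> Q" using Q by simp
  qed
  then have "measure M (\<Inter>k. U k) \<le> measure M {u. reflect u x \<in> Q}"
  proof (rule finite_measure_mono)
    have [measurable]: "Q \<in> sets borel" using Q(1) by simp
    show "{u. reflect u x \<in> Q} \<in> sets M" by measurable
  qed
  moreover have "measure M Q \<le> 10 ^ DIM('a) * measure M (U k)" for k
    unfolding U_def using x Q by (intro reflect_law_nbhd) auto
  ultimately have "measure M Q \<le> 10 ^ DIM('a) * measure M (\<Inter>k. U k)"
    by (intro LIMSEQ_le_const[OF tendsto_mult_left]) auto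
  also have "\<dots> \<le> 10 ^ DIM('a) * measure M {u. reflect u x \<in> Q}"
    using \<open>measure M (\<Inter>k. U k) \<le> measure M {u. reflect u x \<in> Q}\<close> by simp
  finally show ?thesis .
qed

text \<open>Inner regularity reduces Borel sets to compact ones.\<close>

lemma reflect_law:
  assumes x: "norm x = 1" and Q: "Q \<in> sets borel" "Q \<subseteq> sphere 0 1" "x \<notin> Q"
  shows "measure M Q \<le> 10 ^ DIM('a) * measure M {u. reflect u x \<in> Q}"
proof -
  note Q(1)[measurable]
  have "emeasure M Q = (SUP K\<in>{K. K \<subseteq> Q \<and> compact K}. emeasure M K)"
    using Q(1) by (intro inner_regular sets_M) (auto simp: emeasure_eq_measure)
  also have "\<dots> \<le> ennreal (10 ^ DIM('a) * measure M {u. reflect u x \<in> Q})"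
  proof (rule SUP_least)
    fix K assume "K \<in> {K. K \<subseteq> Q \<and> compact K}"
    then have K: "K \<subseteq> Q" "compact K" by auto
    have "measure M K \<le> 10 ^ DIM('a) * measure M {u. reflect u x \<in> K}"
      using K Q x by (intro reflect_law_closed compact_imp_closed) auto
    also have "\<dots> \<le> 10 ^ DIM('a) * measure M {u. reflect u x \<in> Q}"
      using K by (intro mult_left_mono finite_measure_mono) auto
    finally show "emeasure M K \<le> ennreal (10 ^ DIM('a) * measure M {u. reflect u x \<in> Q})"
      by (simp add: emeasure_eq_measure)
  qed
  finally show ?thesis by (simp add: emeasure_eq_measure)
qed

text \<open>By \<open>reflect_law\<close> and Fubini, the average over \<open>u\<close> of the
  overlap is at least \<open>measure M P * measure M Q / K\<close>. If the claim failed, every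
  overlap would be at most half of this.\<close>

lemma ex_reflect_overlap:
  assumes P: "P \<in> sets borel" "P \<subseteq> sphere 0 1" and Q: "Q \<in> sets borel" "Q \<subseteq> sphere 0 1"
    and PQ: "P \<inter> Q = {}"
  shows "\<exists>u. measure M P * measure M Q \<le> 2 * 10 ^ DIM('a) * measure M {x \<in> P. reflect u x \<in> Q}"
proof (rule ccontr)
  assume "\<not> ?thesis"
  then have less: "2 * 10 ^ DIM('a) * measure M {x \<in> P. reflect u x \<in> Q} < measure M P * measure M Q" for u
    by (simp add: not_le)
  interpret pair_sigma_finite M M ..
  note P(1)[measurable] Q(1)[measurable]
  define a where "a = measure M P * measure M Q"
  define K where "K = (10 :: real) ^ DIM('a)"
  have K: "K > 0" by (simp add: K_def)
  \<comment> \<open>The negated claim is strict and its left side is nonnegative.\<close>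
  have a: "a > 0" using less[of 0] unfolding a_def
    by (rule le_less_trans[rotated]) simp
  define g :: "'a \<Rightarrow> 'a \<Rightarrow> ennreal" where "g x u = indicator P x * indicator Q (reflect u x)" for x u
  have gm: "case_prod g \<in> borel_measurable (M \<Otimes>\<^sub>M M)"
    unfolding g_def by measurable
  have m1: "{x \<in> P. reflect u x \<in> Q} \<in> sets borel" for u by measurable
  have m2: "{u. reflect u x \<in> Q} \<in> sets borel" for x by measurable
  have "ennreal (a / K) = (\<integral>\<^sup>+x. ennreal (measure M Q / K) * indicator P x \<partial>M)"
    using P(1) K by (simp add: nn_integral_cmult_indicator emeasure_eq_measure a_def ennreal_mult[symmetric])
  also have "\<dots> \<le> (\<integral>\<^sup>+x. \<integral>\<^sup>+u. g x u \<partial>M \<partial>M)"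
  proof (intro nn_integral_mono)
    fix x
    show "ennreal (measure M Q / K) * indicator P x \<le> (\<integral>\<^sup>+u. g x u \<partial>M)"
    proof (cases "x \<in> P")
      case True
      then have "norm x = 1" "x \<notin> Q" using P(2) PQ by auto
      then have "measure M Q \<le> K * measure M {u. reflect u x \<in> Q}"
        using reflect_law[of x Q] Q by (simp add: K_def)
      then have "measure M Q / K \<le> measure M {u. reflect u x \<in> Q}"
        using K by (simp add: pos_divide_le_eq mult.commute)
      moreover have "(\<integral>\<^sup>+u. g x u \<partial>M) = (\<integral>\<^sup>+u. indicator {u. reflect u x \<in> Q} u \<partial>M)"
        using True by (intro nn_integral_cong) (auto simp: g_def indicator_def)
      ultimately show ?thesis using True m2[of x] by (simp add: emeasure_eq_measure ennreal_leI)
    qed simp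
  qed
  also have "\<dots> = (\<integral>\<^sup>+u. \<integral>\<^sup>+x. g x u \<partial>M \<partial>M)"
    using Fubini'[OF gm] by simp
  also have "\<dots> \<le> (\<integral>\<^sup>+u. ennreal (a / (2 * K)) \<partial>M)"
  proof (intro nn_integral_mono)
    fix u
    have "(\<integral>\<^sup>+x. g x u \<partial>M) = (\<integral>\<^sup>+x. indicator {x \<in> P. reflect u x \<in> Q} x \<partial>M)"
      by (intro nn_integral_cong) (auto simp: g_def indicator_def)
    also have "\<dots> = ennreal (measure M {x \<in> P. reflect u x \<in> Q})"
      using m1[of u] by (simp add: emeasure_eq_measure)
    also have "\<dots> \<le> ennreal (a / (2 * K))"
      using less[of u] K by (intro ennreal_leI) (simp add: K_def a_def pos_le_divide_eq mult_ac)
    finally show "(\<integral>\<^sup>+x. g x u \<partial>M) \<le> ennreal (a / (2 * K))" .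
  qed
  also have "\<dots> = ennreal (a / (2 * K))"
    by (simp add: emeasure_space_1[simplified])
  finally have "a / K \<le> a / (2 * K)" using a K by (simp add: ennreal_le_iff)
  then show False using a K by (simp add: field_simps)
qed

end

subsection \<open>Polarization\<close>

text \<open>Two-point rearrangement: a mirror pair with exactly one point in \<open>A\<close> keeps
  one point, placed on the side \<open>0 \<le> x \<bullet> u\<close>; other pairs are
  unchanged.\<close>

definition polarize :: "'a :: euclidean_space \<Rightarrow> 'a set \<Rightarrow> 'a set" where
  "polarize u A = {x. if 0 \<le> x \<bullet> u then x \<in> A \<or> reflect u x \<in> A else x \<in> A \<and> reflect u x \<in> A}"

text \<open>On the sphere this is the enlargement by the angle $\arccos c$; no infimum is involved.\<close>

definition cap_nbhd :: "'a :: euclidean_space set \<Rightarrow> real \<Rightarrow> 'a set" where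
  "cap_nbhd A c = {x. \<exists>a\<in>A. c < x \<bullet> a}"

lemma open_cap_nbhd: "open (cap_nbhd A c)"
proof -
  have "cap_nbhd A c = (\<Union>a\<in>A. {x. c < x \<bullet> a})" by (auto simp: cap_nbhd_def)
  then show ?thesis by (auto intro!: open_Collect_less continuous_intros)
qed

lemma borel_polarize:
  assumes [measurable]: "A \<in> sets borel"
  shows "polarize u A \<in> sets borel"
  unfolding polarize_def by measurable

lemma polarize_subset_sphere: "A \<subseteq> sphere 0 1 \<Longrightarrow> polarize u A \<subseteq> sphere 0 1"
  unfolding polarize_def by (auto split: if_splits)

text \<open>The key inequality is $\langle x, s_u a\rangle \ge \langle x, a\rangle$ when $x$ and $a$ lie on
  opposite sides of the hyperplane.\<close>

lemma cap_nbhd_polarize: "cap_nbhd (polarize u A) c \<subseteq> polarize u (cap_nbhd A c)"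
proof
  fix x assume "x \<in> cap_nbhd (polarize u A) c"
  then obtain a where a: "a \<in> polarize u A" "c < x \<bullet> a" by (auto simp: cap_nbhd_def)
  show "x \<in> polarize u (cap_nbhd A c)"
  proof (cases "0 \<le> x \<bullet> u")
    case True
    have "a \<in> A \<or> reflect u a \<in> A" using a(1) by (auto simp: polarize_def split: if_splits)
    moreover have "c < reflect u x \<bullet> reflect u a" using a(2) by simp
    ultimately show ?thesis
      using a(2) True by (auto simp: polarize_def cap_nbhd_def simp del: inner_reflect_reflect)
  next
    case False
    show ?thesis
    proof (cases "0 \<le> a \<bullet> u")
      case True
      have "(x \<bullet> u) * (a \<bullet> u) \<le> 0" using True False by (simp add: mult_nonpos_nonneg)
      then have "2 * (x \<bullet> u) * (a \<bullet> u) \<le> 0" by linarith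
      then have "2 * (x \<bullet> u) * (a \<bullet> u) / (u \<bullet> u) \<le> 0" by (intro divide_nonpos_nonneg) simp_all
      then have "c < reflect u x \<bullet> a" using a(2) unfolding inner_reflect by linarith
      then have "c < x \<bullet> reflect u a" "c < reflect u x \<bullet> a" "c < reflect u x \<bullet> reflect u a"
        using a(2) by (simp_all add: inner_reflect_commute)
      moreover have "a \<in> A \<or> reflect u a \<in> A" using a(1) True by (auto simp: polarize_def)
      ultimately show ?thesis
        using a(2) False by (auto simp: polarize_def cap_nbhd_def simp del: inner_reflect_reflect)
    next
      case neg: False
      have "c < reflect u x \<bullet> reflect u a" using a(2) by simp
      moreover have "a \<in> A \<and> reflect u a \<in> A" using a(1) neg by (auto simp: polarize_def)
      ultimately show ?thesis
        using a(2) False by (auto simp: polarize_def cap_nbhd_def simp del: inner_reflect_reflect)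
    qed
  qed
qed

text \<open>
  The margins by which \<open>y\<close> lies inside the hemisphere and inside the cap of angle \<open>t\<close> around \<open>x\<close> do
  not depend on \<open>x\<close>. Hence a set that fills the hemisphere up to a sufficiently small measure meets
  all of these caps.
\<close>

lemma ex_hemisphere_near:
  fixes x e :: "'a :: euclidean_space"
  assumes x: "norm x = 1" and e: "norm e = 1" and st: "0 < s" "s < t" "t \<le> pi/2"
    and xe: "- sin s < x \<bullet> e"
  shows "\<exists>y. norm y = 1 \<and> sin ((t - s) / 2) \<le> y \<bullet> e \<and> cos ((s + t) / 2) \<le> x \<bullet> y"
proof -
  define \<delta> where "\<delta> = (t - s) / 2"
  have \<delta>: "0 < \<delta>" "\<delta> < pi/2" using st by (auto simp: \<delta>_def)
  define \<alpha> where "\<alpha> = arccos (x \<bullet> e)"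
  have b: "\<bar>x \<bullet> e\<bar> \<le> 1" using Cauchy_Schwarz_ineq2[of x e] x e by simp
  then have ca: "cos \<alpha> = x \<bullet> e" by (simp add: \<alpha>_def)
  have a0: "0 \<le> \<alpha>" "\<alpha> \<le> pi" using b by (auto simp: \<alpha>_def abs_le_iff intro!: arccos_lbound arccos_ubound)
  show ?thesis
  proof (cases "\<alpha> \<le> pi/2 - \<delta>")
    case True
    then have "cos (pi/2 - \<delta>) \<le> cos \<alpha>" using a0 \<delta> by (intro cos_monotone_0_pi_le) auto
    then have "sin \<delta> \<le> x \<bullet> e" by (simp add: ca cos_diff)
    moreover have "x \<bullet> x = 1" using x by (simp add: norm_eq_1)
    ultimately show ?thesis using x by (intro exI[of _ x]) (simp add: \<delta>_def)
  next
    case False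
    have "cos (pi/2 + s) < cos \<alpha>" using xe by (simp add: ca cos_add)
    then have a2: "\<alpha> < pi/2 + s" using a0 st
      by (subst (asm) cos_mono_less_eq) auto
    have sa: "0 < sin \<alpha>" using False a2 st \<delta> by (intro sin_gt_zero) auto
    \<comment> \<open>\<open>w\<close> is the unit vector orthogonal to \<open>e\<close> with
      \<open>x = cos \<alpha> *\<^sub>R e + sin \<alpha> *\<^sub>R w\<close>.\<close>
    define w where "w = (x - cos \<alpha> *\<^sub>R e) /\<^sub>R sin \<alpha>"
    have ee: "e \<bullet> e = 1" "x \<bullet> x = 1" using x e by (simp_all add: norm_eq_1)
    have we: "w \<bullet> e = 0" using ee by (simp add: w_def inner_diff_left ca)
    have sc: "1 - cos \<alpha> * cos \<alpha> = sin \<alpha> * sin \<alpha>"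
      using sin_squared_eq[of \<alpha>] by (simp add: power2_eq_square)
    have "(x - cos \<alpha> *\<^sub>R e) \<bullet> (x - cos \<alpha> *\<^sub>R e) = sin \<alpha> * sin \<alpha>"
      using ee sc by (simp add: inner_diff_left inner_diff_right inner_commute[of e x] ca[symmetric])
    then have ww: "w \<bullet> w = 1"
      using sa by (simp add: w_def) (simp add: field_simps)
    have xw: "x \<bullet> w = sin \<alpha>"
      using ee sc sa by (simp add: w_def inner_diff_right ca[symmetric])
    \<comment> \<open>On the great circle through \<open>e\<close> and \<open>x\<close>,
      \<open>y\<close> has angle \<open>pi/2 - \<delta>\<close> from \<open>e\<close>, hence angle
      \<open>\<alpha> + \<delta> - pi/2 < s + \<delta>\<close> from \<open>x\<close>.\<close>
    define y where "y = sin \<delta> *\<^sub>R e + cos \<delta> *\<^sub>R w"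
    have "y \<bullet> y = (sin \<delta>)\<^sup>2 + (cos \<delta>)\<^sup>2"
      using we ww ee by (simp add: y_def inner_add_left inner_add_right inner_commute[of e w] power2_eq_square)
    then have "norm y = 1" by (simp add: norm_eq_1)
    moreover have "y \<bullet> e = sin \<delta>" using we ee by (simp add: y_def inner_add_left)
    moreover have "cos ((s + t) / 2) \<le> x \<bullet> y"
    proof -
      have "x \<bullet> y = cos (\<alpha> + \<delta> - pi/2)"
        by (simp add: y_def inner_add_right xw ca[symmetric] cos_diff sin_add algebra_simps)
      moreover have "cos (s + \<delta>) \<le> cos (\<alpha> + \<delta> - pi/2)"
        using False a2 st \<delta> by (intro cos_monotone_0_pi_le) auto
      moreover have "s + \<delta> = (s + t) / 2" by (simp add: \<delta>_def field_simps)
      ultimately show ?thesis by simp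
    qed
    ultimately show ?thesis by (intro exI[of _ y]) (simp add: \<delta>_def)
  qed
qed

section \<open>Polarization and measure\<close>

context invariant_sphere_prob
begin

text \<open>Integrating the hypothesis gives twice each measure by invariance. Measures can thus be
  compared by counting points in each mirror pair.\<close>

lemma measure_le_reflect:
  assumes A: "A \<in> sets borel" and B: "B \<in> sets borel"
    and le: "\<And>x. indicator A x + indicator A (reflect u x) \<le> (indicator B x + indicator B (reflect u x) :: real)"
  shows "measure M A \<le> measure M B"
proof -
  have int: "integrable M (\<lambda>x. indicator S x :: real)" "integrable M (\<lambda>x. indicator S (reflect u x) :: real)"
    and eq: "(\<integral>x. indicator S x + indicator S (reflect u x) \<partial>M) = 2 * measure M S" if S: "S \<in> sets borel" for S
  proof -
    note [measurable] = S
    show i1: "integrable M (\<lambda>x. indicator S x :: real)"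
      by (intro integrable_const_bound[of _ 1]) (auto simp: indicator_def)
    show i2: "integrable M (\<lambda>x. indicator S (reflect u x) :: real)"
      by (intro integrable_const_bound[of _ 1]) (auto simp: indicator_def)
    have "(\<integral>x. indicator S (reflect u x) \<partial>M) = (\<integral>x. (indicator S x :: real) \<partial>M)"
      by (intro integral_orthogonal orthogonal_transformation_reflect) auto
    then show "(\<integral>x. indicator S x + indicator S (reflect u x) \<partial>M) = 2 * measure M S"
      using i1 i2 S by simp
  qed
  have "2 * measure M A \<le> 2 * measure M B"
    unfolding eq[OF A, symmetric] eq[OF B, symmetric]
    by (intro integral_mono Bochner_Integration.integrable_add int A B le)
  then show ?thesis by simp
qed

text \<open>Each mirror pair keeps its number of points.\<close>

lemma measure_polarize:
  assumes A: "A \<in> sets borel"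
  shows "measure M (polarize u A) = measure M A"
proof -
  have "indicator (polarize u A) x + indicator (polarize u A) (reflect u x)
      = (indicator A x + indicator A (reflect u x) :: real)" for x
  proof (cases "x \<bullet> u = 0")
    case True
    then have "reflect u x = x" by (simp add: reflect_def)
    then show ?thesis using True by (simp add: polarize_def indicator_def)
  next
    case False
    then show ?thesis by (auto simp: polarize_def indicator_def reflect_inner_self)
  qed
  then show ?thesis
    using A borel_polarize[OF A] by (intro antisym measure_le_reflect[of _ _ u]) simp_all
qed

text \<open>Mirror pairs are compared one by one. With \<open>e\<close> on the nonnegative side of
  the hyperplane, polarization never loses points of \<open>C\<close> on balance, and it fills every
  missing point of \<open>C\<close> whose mirror image lies in \<open>A - C\<close>.\<close>

lemma measure_hemisphere_diff_polarize:
  assumes A: "A \<in> sets borel" and u: "0 \<le> e \<bullet> u"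
  defines "C \<equiv> {x \<in> sphere 0 1. 0 < x \<bullet> e}"
  shows "measure M (C - polarize u A) + measure M {x \<in> C - A. reflect u x \<in> A - C} \<le> measure M (C - A)"
proof -
  note A[measurable]
  have C[measurable]: "C \<in> sets borel" unfolding C_def by measurable
  have pA[measurable]: "polarize u A \<in> sets borel" by (rule borel_polarize[OF A])
  define G where "G = {x \<in> C - A. reflect u x \<in> A - C}"
  have G[measurable]: "G \<in> sets borel" unfolding G_def by measurable
  \<comment> \<open>On the side of \<open>e\<close> a point has at least as large an inner product
    with \<open>e\<close> as its mirror image.\<close>
  have up: "x \<in> C" if "0 \<le> x \<bullet> u" "reflect u x \<in> C" for x
  proof -
    have "0 \<le> 2 * (x \<bullet> u) * (e \<bullet> u) / (u \<bullet> u)" using that u by simp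
    then show ?thesis using that by (auto simp: C_def inner_reflect)
  qed
  have "x \<in> polarize u A" if "x \<in> G" for x
  proof -
    have x: "x \<notin> A" "reflect u x \<in> A" "reflect u x \<notin> C" "x \<in> C" using that by (auto simp: G_def)
    have "0 \<le> x \<bullet> u"
    proof (rule ccontr)
      assume "\<not> 0 \<le> x \<bullet> u"
      then have "reflect u x \<in> C" using x up[of "reflect u x"] by (simp add: reflect_inner_self)
      then show False using x by simp
    qed
    then show ?thesis using x by (simp add: polarize_def)
  qed
  then have dis: "(C - polarize u A) \<inter> G = {}" by blast
  have G1: "x \<in> G \<longleftrightarrow> x \<in> C \<and> x \<notin> A \<and> reflect u x \<in> A \<and> reflect u x \<notin> C"
    and G2: "reflect u x \<in> G \<longleftrightarrow> reflect u x \<in> C \<and> reflect u x \<notin> A \<and> x \<in> A \<and> x \<notin> C" for x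
    by (auto simp: G_def)
  have le: "indicator ((C - polarize u A) \<union> G) x + indicator ((C - polarize u A) \<union> G) (reflect u x)
    \<le> (indicator (C - A) x + indicator (C - A) (reflect u x) :: real)" if x: "0 \<le> x \<bullet> u" for x
  proof (cases "x \<bullet> u = 0")
    case True
    then have "reflect u x = x" by (simp add: reflect_def)
    then show ?thesis using True by (simp add: polarize_def G1 indicator_def)
  next
    case False
    then have "x \<in> polarize u A \<longleftrightarrow> x \<in> A \<or> reflect u x \<in> A" "reflect u x \<in> polarize u A \<longleftrightarrow> x \<in> A \<and> reflect u x \<in> A"
      using x by (auto simp: polarize_def reflect_inner_self)
    then show ?thesis
      unfolding indicator_def Un_iff Diff_iff G1 G2
      using up[OF x] by (cases "x \<in> A"; cases "reflect u x \<in> A"; cases "reflect u x \<in> C"; simp)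
  qed
  have "measure M ((C - polarize u A) \<union> G) \<le> measure M (C - A)"
  proof (rule measure_le_reflect)
    fix x
    show "indicator ((C - polarize u A) \<union> G) x + indicator ((C - polarize u A) \<union> G) (reflect u x)
      \<le> (indicator (C - A) x + indicator (C - A) (reflect u x) :: real)"
    proof (cases "0 \<le> x \<bullet> u")
      case False
      then show ?thesis using le[of "reflect u x"] by (simp add: reflect_inner_self add.commute)
    qed (rule le)
  qed auto
  then show ?thesis
    unfolding G_def[symmetric] using dis by (subst finite_measure_Union[symmetric]) simp_all
qed

text \<open>
  Among the sets reachable from \<open>A\<close> by polarizations, the infimum \<open>d\<close> of the mass missing from the
  hemisphere is zero: averaging over all reflections, one polarization lowers a missing mass close
  to \<open>d\<close> by a fixed multiple of $d^2$.
\<close>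

lemma ex_polarized_near_hemisphere:
  assumes e: "norm e = 1" and A: "A \<in> sets borel" "A \<subseteq> sphere 0 1" "1/2 \<le> measure M A" and \<epsilon>: "0 < \<epsilon>"
  defines "C \<equiv> {x \<in> sphere 0 1. 0 < x \<bullet> e}"
  shows "\<exists>B. B \<in> sets borel \<and> measure M (cap_nbhd B c) \<le> measure M (cap_nbhd A c) \<and> measure M (C - B) < \<epsilon>"
proof (rule ccontr)
  assume neg: "\<not> ?thesis"
  \<comment> \<open>Instead of iterated polarizations, \<open>\<A>\<close> collects all sets with
    the properties of \<open>A\<close> that a polarization preserves.\<close>
  define \<A> where "\<A> = {B \<in> sets borel. B \<subseteq> sphere 0 1 \<and> 1/2 \<le> measure M B
    \<and> measure M (cap_nbhd B c) \<le> measure M (cap_nbhd A c)}"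
  define d where "d = (INF B\<in>\<A>. measure M (C - B))"
  define K where "K = 2 * (10 :: real) ^ DIM('a)"
  have K: "K > 0" by (simp add: K_def)
  have AA: "A \<in> \<A>" using A by (simp add: \<A>_def)
  have bdd: "bdd_below ((\<lambda>B. measure M (C - B)) ` \<A>)" by (intro bdd_belowI[of _ 0]) auto
  have lower: "d \<le> measure M (C - B)" if "B \<in> \<A>" for B
    unfolding d_def using bdd that by (rule cINF_lower)
  have "\<epsilon> \<le> d"
    unfolding d_def using AA neg by (intro cINF_greatest) (auto simp: \<A>_def not_less)
  then have d: "0 < d" using \<epsilon> by simp
  have C[measurable]: "C \<in> sets borel" unfolding C_def by measurable
  have C_half: "measure M C \<le> 1/2"
  proof -
    have "measure M {x. - x \<in> C} = measure M C"
      by (intro measure_orthogonal C) (simp add: orthogonal_transformation_neg)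
    moreover have "measure M (C \<union> {x. - x \<in> C}) = measure M C + measure M {x. - x \<in> C}"
      by (intro finite_measure_Union) (auto simp: C_def)
    ultimately show ?thesis using prob_le_1[of "C \<union> {x. - x \<in> C}"] by simp
  qed
  have "0 < d\<^sup>2 / K" using d K by simp
  then have "d < d + d\<^sup>2 / K" by simp
  then obtain B where B: "B \<in> \<A>" "measure M (C - B) < d + d\<^sup>2 / K"
    using AA bdd unfolding d_def by (subst (asm) cINF_less_iff) auto
  have Bm[measurable]: "B \<in> sets borel" and Bs: "B \<subseteq> sphere 0 1" and Bh: "1/2 \<le> measure M B"
    and Bn: "measure M (cap_nbhd B c) \<le> measure M (cap_nbhd A c)"
    using B(1) by (auto simp: \<A>_def)
  have "measure M B = measure M (B - C) + measure M (B \<inter> C)"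
    by (subst finite_measure_Union[symmetric]) (auto intro!: arg_cong[of _ _ "measure M"])
  moreover have "measure M C = measure M (C - B) + measure M (B \<inter> C)"
    by (subst finite_measure_Union[symmetric]) (auto intro!: arg_cong[of _ _ "measure M"])
  \<comment> \<open>Since \<open>B\<close> has at least the mass of \<open>C\<close>, its excess
    outside \<open>C\<close> is at least what it misses inside.\<close>
  ultimately have "measure M (C - B) \<le> measure M (B - C)" using Bh C_half by linarith
  then have dd: "d * d \<le> measure M (C - B) * measure M (B - C)"
    using lower[OF B(1)] d by (intro mult_mono) auto
  have "\<exists>u. measure M (C - B) * measure M (B - C) \<le> 2 * 10 ^ DIM('a) * measure M {x \<in> C - B. reflect u x \<in> B - C}"
    using Bs by (intro ex_reflect_overlap) (auto simp: C_def)
  then obtain u where u: "d * d \<le> K * measure M {x \<in> C - B. reflect u x \<in> B - C}"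
    using dd unfolding K_def by (meson order_trans)
  have "\<exists>u. 0 \<le> e \<bullet> u \<and> d * d \<le> K * measure M {x \<in> C - B. reflect u x \<in> B - C}"
  proof (cases "0 \<le> e \<bullet> u")
    case False
    \<comment> \<open>The normal may be reversed to put \<open>e\<close> on its nonnegative
      side.\<close>
    have "reflect (- u) = reflect u" by (auto simp: reflect_def)
    then show ?thesis using False u by (intro exI[of _ "- u"]) auto
  qed (use u in blast)
  then obtain v where v: "0 \<le> e \<bullet> v" "d * d \<le> K * measure M {x \<in> C - B. reflect v x \<in> B - C}"
    by blast
  have "measure M (C - polarize v B) + measure M {x \<in> C - B. reflect v x \<in> B - C} \<le> measure M (C - B)"
    unfolding C_def by (rule measure_hemisphere_diff_polarize[OF Bm v(1)])
  moreover have "d\<^sup>2 / K \<le> measure M {x \<in> C - B. reflect v x \<in> B - C}"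
    using v(2) K by (simp add: pos_divide_le_eq power2_eq_square mult.commute)
  ultimately have "measure M (C - polarize v B) < d" using B(2) by linarith
  moreover have "polarize v B \<in> \<A>"
  proof -
    have "measure M (cap_nbhd (polarize v B) c) \<le> measure M (polarize v (cap_nbhd B c))"
      by (intro finite_measure_mono cap_nbhd_polarize) (simp add: sets_M borel_polarize borel_open open_cap_nbhd)
    also have "\<dots> = measure M (cap_nbhd B c)"
      by (intro measure_polarize borel_open open_cap_nbhd)
    finally show ?thesis
      using Bn Bh Bs by (simp add: \<A>_def borel_polarize polarize_subset_sphere measure_polarize)
  qed
  ultimately show False using lower[of "polarize v B"] by simp
qed

text \<open>Take a set \<open>B\<close> that misses less of the hemisphere than the mass of a ball
  of radius \<open>\<eta>\<close>. Every point of the sphere above the level \<open>- sin s\<close>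
  then lies in the neighbourhood of \<open>B\<close>, whose measure does not exceed that of the
  neighbourhood of \<open>A\<close>.\<close>

lemma measure_cap_nbhd_ge:
  assumes e: "norm e = 1" and A: "A \<in> sets borel" "A \<subseteq> sphere 0 1" "1/2 \<le> measure M A"
    and st: "0 < s" "s < t" "t \<le> pi/2"
  shows "1 - measure M {x. sin s \<le> x \<bullet> e} \<le> measure M (cap_nbhd A (cos t))"
proof -
  \<comment> \<open>The two margins supplied by \<open>ex_hemisphere_near\<close>: moving
    \<open>y\<close> by less than \<open>\<eta>\<close> leaves it in the hemisphere and in the cap
    around \<open>x\<close>.\<close>
  define \<eta> where "\<eta> = min (sin ((t - s) / 2)) (cos ((s + t) / 2) - cos t)"
  have "cos t < cos ((s + t) / 2)" using st by (intro cos_monotone_0_pi) auto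
  moreover have "0 < sin ((t - s) / 2)" using st by (intro sin_gt_zero) auto
  ultimately have \<eta>: "0 < \<eta>" by (simp add: \<eta>_def)
  define C where "C = {x \<in> sphere 0 1. 0 < x \<bullet> e}"
  have C[measurable]: "C \<in> sets borel" unfolding C_def by measurable
  obtain B where B[measurable]: "B \<in> sets borel" and nb: "measure M (cap_nbhd B (cos t)) \<le> measure M (cap_nbhd A (cos t))"
    and CB: "measure M (C - B) < measure M (ball e \<eta>)"
    using ex_polarized_near_hemisphere[OF e A measure_ball_pos[OF e \<eta>]] unfolding C_def by blast
  have "x \<in> cap_nbhd B (cos t)" if x: "norm x = 1" "- sin s < x \<bullet> e" for x
  proof -
    obtain y where y: "norm y = 1" "sin ((t - s) / 2) \<le> y \<bullet> e" "cos ((s + t) / 2) \<le> x \<bullet> y"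
      using ex_hemisphere_near[OF x(1) e st x(2)] by blast
    have y': "\<eta> \<le> y \<bullet> e" "cos t + \<eta> \<le> x \<bullet> y" using y by (auto simp: \<eta>_def min_def)
    \<comment> \<open>The ball around \<open>y\<close> has the mass of the ball around
      \<open>e\<close>, too much to fit into \<open>C - B\<close>.\<close>
    have "\<not> ball y \<eta> \<inter> sphere 0 1 \<subseteq> C - B"
    proof
      assume "ball y \<eta> \<inter> sphere 0 1 \<subseteq> C - B"
      then have "measure M (ball y \<eta> \<inter> sphere 0 1) \<le> measure M (C - B)"
        by (intro finite_measure_mono) auto
      then show False
        using CB measure_ball_eq[OF y(1) e, of \<eta>] by (simp add: measure_Int_sphere)
    qed
    then obtain z where z: "dist y z < \<eta>" "norm z = 1" "z \<notin> C - B"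
      unfolding subset_eq by (metis IntE mem_ball mem_sphere_0)
    have "\<bar>(z - y) \<bullet> e\<bar> < \<eta>" "\<bar>x \<bullet> (z - y)\<bar> < \<eta>"
      using Cauchy_Schwarz_ineq2[of "z - y" e] Cauchy_Schwarz_ineq2[of x "z - y"] z(1) e x(1)
      by (auto simp: dist_norm norm_minus_commute)
    then have "0 < z \<bullet> e" "cos t < x \<bullet> z"
      using y' by (auto simp: inner_diff_left inner_diff_right)
    then show ?thesis using z by (auto simp: C_def cap_nbhd_def)
  qed
  then have sub: "{x. - sin s < x \<bullet> e} \<inter> sphere 0 1 \<subseteq> cap_nbhd B (cos t)" by auto
  \<comment> \<open>The antipodal map turns the upper cap into the complement of the region just
    covered.\<close>
  have "measure M {x. sin s \<le> x \<bullet> e} = measure M {x. sin s \<le> - x \<bullet> e}"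
    using measure_orthogonal[of uminus "{x. sin s \<le> x \<bullet> e}"]
    by (simp add: orthogonal_transformation_neg)
  then have "1 - measure M {x. sin s \<le> x \<bullet> e} = 1 - measure M {x. sin s \<le> - x \<bullet> e}" by simp
  also have "\<dots> = measure M (UNIV - {x. sin s \<le> - x \<bullet> e})"
    by (subst prob_compl[symmetric, simplified]) auto
  also have "UNIV - {x. sin s \<le> - x \<bullet> e} = {x. - sin s < x \<bullet> e}" by auto
  also have "measure M {x. - sin s < x \<bullet> e} = measure M ({x. - sin s < x \<bullet> e} \<inter> sphere 0 1)"
    by (rule measure_Int_sphere[symmetric]) measurable
  also have "\<dots> \<le> measure M (cap_nbhd B (cos t))"
    by (intro finite_measure_mono sub) (simp add: sets_M borel_open open_cap_nbhd)
  finally show ?thesis using nb by simp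
qed

text \<open>The midpoint \<open>(s + t) / 2\<close> leaves room for the strict inequalities in both
  the cap estimate and the comparison with the hemisphere; then \<open>s\<close> tends to
  \<open>t\<close> from the left.\<close>

lemma cap_nbhd_concentration:
  assumes n: "2 < DIM('a)" and A: "A \<in> sets borel" "A \<subseteq> sphere 0 1" "1/2 \<le> measure M A"
    and t: "0 < t" "t \<le> pi/2"
  shows "1 - 1/2 * exp (- (real DIM('a) * t\<^sup>2 / 2)) \<le> measure M (cap_nbhd A (cos t))"
proof (rule tendsto_upperbound)
  obtain e :: 'a where e: "e \<in> Basis" using nonempty_Basis by blast
  show "((\<lambda>s. 1 - 1/2 * exp (- (real DIM('a) * s\<^sup>2 / 2))) \<longlongrightarrow> 1 - 1/2 * exp (- (real DIM('a) * t\<^sup>2 / 2))) (at_left t)"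
    by (intro tendsto_intros) simp_all
  show "\<forall>\<^sub>F s in at_left t. 1 - 1/2 * exp (- (real DIM('a) * s\<^sup>2 / 2)) \<le> measure M (cap_nbhd A (cos t))"
    using eventually_at_left_real[OF t(1)]
  proof eventually_elim
    case (elim s)
    then have s: "0 < s" "s < t" by auto
    have "measure M {x. sin ((s + t) / 2) \<le> x \<bullet> e} \<le> 1/2 * exp (- (real DIM('a) * s\<^sup>2 / 2))"
      using s t n by (intro cap_measure_le e) auto
    moreover have "1 - measure M {x. sin ((s + t) / 2) \<le> x \<bullet> e} \<le> measure M (cap_nbhd A (cos t))"
      using s t e by (intro measure_cap_nbhd_ge A) auto
    ultimately show ?case by linarith
  qed
qed simp

end

subsection \<open>Concentration\<close>

context invariant_sphere_prob
begin

text \<open>If \<open>x\<close> were missed, \<open>A\<close> would lie in the cap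
  \<open>x \<bullet> a \<le> c\<close>. This cap, its antipode and a ball of radius
  \<open>- c\<close> around a unit vector orthogonal to \<open>x\<close> are disjoint, with total
  mass above 1.\<close>

lemma cap_nbhd_eq_sphere:
  assumes n: "2 \<le> DIM('a)" and A: "A \<in> sets borel" "1/2 \<le> measure M A" and c: "c < 0"
  shows "sphere 0 1 \<subseteq> cap_nbhd A c"
proof
  fix x :: 'a assume "x \<in> sphere 0 1"
  then have x: "norm x = 1" by simp
  obtain y where y: "y \<noteq> 0" "orthogonal x y"
    using orthogonal_to_vector_exists[OF n] by blast
  define z where "z = y /\<^sub>R norm y"
  have z: "norm z = 1" "x \<bullet> z = 0" using y by (simp_all add: z_def orthogonal_def)
  show "x \<in> cap_nbhd A c"
  proof (rule ccontr)
    assume "x \<notin> cap_nbhd A c"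
    then have sub: "A \<subseteq> {a. x \<bullet> a \<le> c}" by (auto simp: cap_nbhd_def not_less)
    have ball: "\<bar>x \<bullet> a\<bar> < - c" if "a \<in> ball z (- c)" for a
    proof -
      have "\<bar>x \<bullet> a\<bar> = \<bar>x \<bullet> (a - z)\<bar>" using z by (simp add: inner_diff_right)
      also have "\<dots> \<le> norm (a - z)" using Cauchy_Schwarz_ineq2[of x "a - z"] x by simp
      finally show ?thesis using that by (simp add: dist_norm norm_minus_commute)
    qed
    have m: "{a. x \<bullet> a \<le> c} \<in> sets M" "{a. x \<bullet> - a \<le> c} \<in> sets M" by measurable
    have "measure M {a. x \<bullet> - a \<le> c} = measure M {a. x \<bullet> a \<le> c}"
      using measure_orthogonal[of uminus "{a. x \<bullet> a \<le> c}"] by (simp add: orthogonal_transformation_neg)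
    then have "2 * measure M {a. x \<bullet> a \<le> c} = measure M ({a. x \<bullet> a \<le> c} \<union> {a. x \<bullet> - a \<le> c})"
      using c m by (subst finite_measure_Union) auto
    moreover have "measure M ({a. x \<bullet> a \<le> c} \<union> {a. x \<bullet> - a \<le> c}) + measure M (ball z (- c))
      = measure M (({a. x \<bullet> a \<le> c} \<union> {a. x \<bullet> - a \<le> c}) \<union> ball z (- c))"
      using m ball by (subst finite_measure_Union[of _ "ball z (- c)"]) (fastforce simp: sets_M)+
    ultimately have "2 * measure M {a. x \<bullet> a \<le> c} + measure M (ball z (- c)) \<le> 1"
      using prob_le_1 by simp
    moreover have "measure M A \<le> measure M {a. x \<bullet> a \<le> c}"
      using m by (intro finite_measure_mono sub) auto
    ultimately show False using A measure_ball_pos[OF z(1), of "- c"] c by simp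
  qed
qed

end

section \<open>Geodesic enlargements and Lipschitz functions\<close>

lemma inner_unit_bounds:
  assumes "norm x = 1" "norm y = 1"
  shows "- 1 \<le> x \<bullet> y" "x \<bullet> y \<le> 1"
  using Cauchy_Schwarz_ineq2[of x y] assms by (simp_all add: abs_le_iff)

lemma bdd_below_geodist:
  assumes x: "norm x = 1" and A: "A \<subseteq> sphere 0 1"
  shows "bdd_below (geodist x ` A)"
proof (rule bdd_belowI)
  fix r assume "r \<in> geodist x ` A"
  then obtain a where "r = geodist x a" "norm a = 1" using A by auto
  then show "0 \<le> r" using inner_unit_bounds[of x a] x by (simp add: geodist_def arccos_lbound)
qed

text \<open>An infimum lies strictly below \<open>t\<close> exactly when some member does, attained
  or not, and \<open>arccos\<close> reverses order.\<close>

lemma enlargement_eq_cap_nbhd: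
  assumes A: "A \<subseteq> sphere 0 1" "A \<noteq> {}" and t: "0 < t" "t \<le> pi"
  shows "enlargement A t = cap_nbhd A (cos t) \<inter> sphere 0 1"
proof -
  have "(INF a\<in>A. geodist x a) < t \<longleftrightarrow> (\<exists>a\<in>A. cos t < x \<bullet> a)" if x: "norm x = 1" for x
  proof -
    have b: "- 1 \<le> x \<bullet> a" "x \<bullet> a \<le> 1" if "a \<in> A" for a
      using inner_unit_bounds[of x a] x A that by auto
    have "bdd_below (geodist x ` A)"
      using x A(1) by (rule bdd_below_geodist)
    then have "(INF a\<in>A. geodist x a) < t \<longleftrightarrow> (\<exists>a\<in>A. geodist x a < t)"
      using A by (intro cINF_less_iff) auto
    also have "\<dots> \<longleftrightarrow> (\<exists>a\<in>A. cos t < x \<bullet> a)"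
    proof (intro bex_cong refl)
      fix a assume "a \<in> A"
      then show "geodist x a < t \<longleftrightarrow> cos t < x \<bullet> a"
        using cos_mono_less_eq[of t "arccos (x \<bullet> a)"] b[of a] t
        by (simp add: geodist_def arccos_lbound arccos_ubound)
    qed
    finally show ?thesis .
  qed
  then show ?thesis by (auto simp: enlargement_def cap_nbhd_def)
qed

lemma enlargement_eq_sphere:
  assumes A: "A \<subseteq> sphere 0 1" "A \<noteq> {}" and t: "pi < t"
  shows "enlargement A t = sphere 0 1"
proof -
  have "(INF a\<in>A. geodist x a) < t" if x: "norm x = 1" for x
  proof -
    obtain a where a: "a \<in> A" using A by auto
    have "(INF a\<in>A. geodist x a) \<le> geodist x a"
      using bdd_below_geodist[OF x A(1)] a by (rule cINF_lower)
    also have "\<dots> \<le> pi"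
      unfolding geodist_def using inner_unit_bounds[of x a] x A a by (intro arccos_ubound) auto
    finally show ?thesis using t by simp
  qed
  then show ?thesis by (auto simp: enlargement_def)
qed

lemma measurable_id_sphere_prob: "(\<lambda>x. x) \<in> measurable \<mu> borel" if "sphere_prob \<mu>"
  using that by (simp add: measurable_cong_sets[of \<mu> "restrict_space borel (sphere 0 1)"] sphere_prob_def
      measurable_restrict_space1)

text \<open>Pushing forward along the inclusion of the sphere makes the results of the locale
  available.\<close>

lemma invariant_sphere_prob_distr:
  assumes \<mu>: "sphere_prob \<mu>"
  shows "invariant_sphere_prob (distr \<mu> borel (\<lambda>x. x))"
proof -
  note id = measurable_id_sphere_prob[OF \<mu>]
  interpret prob_space \<mu> using \<mu> by (simp add: sphere_prob_def)
  interpret D: prob_space "distr \<mu> borel (\<lambda>x. x)" by (rule prob_space_distr[OF id])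
  show ?thesis
  proof unfold_locales
    show "AE x in distr \<mu> borel (\<lambda>x. x). norm x = 1"
      using id space_sphere_prob[OF \<mu>] by (subst AE_distr_iff) auto
  next
    fix T :: "real ^ 'a \<Rightarrow> real ^ 'a" assume T: "orthogonal_transformation T"
    have Tb: "T \<in> borel_measurable borel"
      using orthogonal_transformation_linear[OF T]
      by (intro borel_measurable_continuous_onI linear_continuous_on) (simp add: linear_linear)
    have Tm: "T \<in> measurable \<mu> \<mu>"
    proof (rule measurableI)
      show "T x \<in> space \<mu>" if "x \<in> space \<mu>" for x
        using that orthogonal_transformation_norm[OF T] by (simp add: space_sphere_prob[OF \<mu>])
      fix S assume "S \<in> sets \<mu>"
      then have "S \<in> sets borel" using sets_sphere_prob[OF \<mu>] by blast
      then have "T -` S \<in> sets borel" using measurable_sets[OF Tb] by simp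
      then show "T -` S \<inter> space \<mu> \<in> sets \<mu>"
        by (simp add: sets_sphere_prob[OF \<mu>] space_sphere_prob[OF \<mu>])
    qed
    have "distr (distr \<mu> borel (\<lambda>x. x)) borel T = distr \<mu> borel (T \<circ> (\<lambda>x. x))"
      by (rule distr_distr[OF Tb id])
    also have "\<dots> = distr \<mu> borel ((\<lambda>x. x) \<circ> T)" by (simp add: comp_def)
    also have "\<dots> = distr (distr \<mu> \<mu> T) borel (\<lambda>x. x)"
      by (rule distr_distr[OF id Tm, symmetric])
    also have "distr \<mu> \<mu> T = \<mu>" using \<mu> T by (simp add: sphere_prob_def)
    finally show "distr (distr \<mu> borel (\<lambda>x. x)) borel T = distr \<mu> borel (\<lambda>x. x)" .
  qed simp
qed

text \<open>The concentration estimate is used for \<open>t \<le> pi/2\<close>. Beyond that the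
  enlargement is the whole sphere: by \<open>cap_nbhd_eq_sphere\<close> up to \<open>pi\<close>, and
  because distances never exceed \<open>pi\<close> afterwards.\<close>

lemma sphere_prob_enlargement:
  fixes \<mu> :: "(real ^ 'n) measure"
  assumes n: "CARD('n) > 2" and \<mu>: "sphere_prob \<mu>" and t: "0 < t"
    and A: "A \<subseteq> sphere 0 1" "A \<in> sets borel" "1/2 \<le> measure \<mu> A"
  shows "1 - 1/2 * exp (- (real CARD('n) * t\<^sup>2 / 2)) \<le> measure \<mu> (enlargement A t)"
proof -
  define M where "M = distr \<mu> borel (\<lambda>x. x)"
  interpret invariant_sphere_prob M
    unfolding M_def by (rule invariant_sphere_prob_distr[OF \<mu>])
  have M: "measure \<mu> S = measure M S" if "S \<subseteq> sphere 0 1" "S \<in> sets borel" for S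
    using that measurable_id_sphere_prob[OF \<mu>] unfolding M_def
    by (subst measure_distr) (auto simp: space_sphere_prob[OF \<mu>] Int_absorb2)
  have A': "1/2 \<le> measure M A" using A M by simp
  then have ne: "A \<noteq> {}" by auto
  have full: ?thesis if "enlargement A t = sphere 0 1"
    using that M[of "sphere 0 1"] sphere_measure by simp
  consider "t \<le> pi/2" | "pi/2 < t" "t \<le> pi" | "pi < t" by linarith
  then show ?thesis
  proof cases
    case 1
    have "enlargement A t = cap_nbhd A (cos t) \<inter> sphere 0 1"
      using 1 t pi_gt_zero by (intro enlargement_eq_cap_nbhd A ne) auto
    then have "measure \<mu> (enlargement A t) = measure M (cap_nbhd A (cos t))"
      using M[of "cap_nbhd A (cos t) \<inter> sphere 0 1"] measure_Int_sphere[of "cap_nbhd A (cos t)"]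
      by (simp add: borel_open open_cap_nbhd)
    then show ?thesis using cap_nbhd_concentration[OF _ A(2,1) A' t 1] n by simp
  next
    case 2
    have "cos t < 0"
      using cos_monotone_0_pi[of "pi/2" t] 2 by simp
    then have "sphere 0 1 \<subseteq> cap_nbhd A (cos t)"
      using n by (intro cap_nbhd_eq_sphere A A') auto
    then show ?thesis
      using 2 t by (intro full) (subst enlargement_eq_cap_nbhd[OF A(1) ne], auto)
  next
    case 3
    then show ?thesis by (intro full enlargement_eq_sphere A ne)
  qed
qed

text \<open>\<open>L * arccos (y \<bullet> x)\<close> tends to 0 as \<open>y\<close> tends to
  \<open>x\<close>. Continuity is what makes the level sets Borel.\<close>

lemma geo_lipschitz_continuous_on:
  fixes f :: "real ^ 'n \<Rightarrow> real"
  assumes f: "geo_lipschitz L f"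
  shows "continuous_on (sphere 0 1) f"
  unfolding continuous_on_def
proof
  fix x :: "real ^ 'n" assume x: "x \<in> sphere 0 1"
  have "continuous_on (sphere 0 1) (\<lambda>y. L * arccos (y \<bullet> x))"
  proof (intro continuous_intros ballI)
    fix y :: "real ^ 'n" assume "y \<in> sphere 0 1"
    then show "- 1 \<le> y \<bullet> x \<and> y \<bullet> x \<le> 1" using inner_unit_bounds[of y x] x by simp
  qed
  then have "((\<lambda>y. L * arccos (y \<bullet> x)) \<longlongrightarrow> L * arccos (x \<bullet> x)) (at x within sphere 0 1)"
    using x unfolding continuous_on_def by blast
  then have lim: "((\<lambda>y. L * arccos (y \<bullet> x)) \<longlongrightarrow> 0) (at x within sphere 0 1)"
    using x by (simp add: norm_eq_1)
  have "((\<lambda>y. f y - f x) \<longlongrightarrow> 0) (at x within sphere 0 1)"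
  proof (rule Lim_null_comparison[OF _ lim])
    show "\<forall>\<^sub>F y in at x within sphere 0 1. norm (f y - f x) \<le> L * arccos (y \<bullet> x)"
      using f x by (auto simp: eventually_at_filter geo_lipschitz_def geodist_def)
  qed
  then show "(f \<longlongrightarrow> f x) (at x within sphere 0 1)" by (rule LIM_zero_cancel)
qed

lemma borel_geo_lipschitz_sublevel:
  assumes "geo_lipschitz L f"
  shows "{x \<in> sphere 0 1. f x \<le> c} \<in> sets borel"
proof -
  have "closed (sphere 0 1 \<inter> f -` {..c})"
    by (rule continuous_closed_preimage[OF geo_lipschitz_continuous_on[OF assms]]) auto
  moreover have "sphere 0 1 \<inter> f -` {..c} = {x \<in> sphere 0 1. f x \<le> c}" by auto
  ultimately show ?thesis by (metis borel_closed)
qed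

text \<open>The enlargement of \<open>{f \<le> m}\<close> by \<open>t / L\<close> lies in
  \<open>{f \<le> m + t}\<close>.\<close>

lemma sphere_prob_upper_tail:
  fixes \<mu> :: "(real ^ 'n) measure"
  assumes n: "CARD('n) > 2" and \<mu>: "sphere_prob \<mu>" and L: "0 < L" and f: "geo_lipschitz L f"
    and m: "1/2 \<le> measure \<mu> {x \<in> sphere 0 1. f x \<le> m}" and t: "0 \<le> t"
  shows "measure \<mu> {x \<in> sphere 0 1. m + t < f x} \<le> 1/2 * exp (- (real CARD('n) * t\<^sup>2 / (2 * L\<^sup>2)))"
proof -
  interpret prob_space \<mu> using \<mu> by (simp add: sphere_prob_def)
  define A where "A = {x \<in> sphere 0 1. f x \<le> m}"
  have sub: "{x \<in> sphere 0 1. f x \<le> c} \<in> sets \<mu>" for c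
    using borel_geo_lipschitz_sublevel[OF f] by (auto simp: sets_sphere_prob[OF \<mu>])
  have compl: "measure \<mu> {x \<in> sphere 0 1. c < f x} = 1 - measure \<mu> {x \<in> sphere 0 1. f x \<le> c}" for c
  proof -
    have "{x \<in> sphere 0 1. c < f x} = space \<mu> - {x \<in> sphere 0 1. f x \<le> c}"
      by (auto simp: space_sphere_prob[OF \<mu>])
    then show ?thesis using prob_compl[OF sub[of c]] by simp
  qed
  show ?thesis
  \<comment> \<open>The enlargement estimate needs a positive radius; for \<open>t = 0\<close> the
    bound \<open>1/2\<close> is the median property itself.\<close>
  proof (cases "t = 0")
    case True
    then show ?thesis using m compl[of m] by simp
  next
    case False
    then have t: "0 < t / L" using t L by simp
    have A: "A \<subseteq> sphere 0 1" "A \<in> sets borel" "1/2 \<le> measure \<mu> A"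
      using m borel_geo_lipschitz_sublevel[OF f] by (auto simp: A_def)
    then have ne: "A \<noteq> {}" by auto
    have "enlargement A (t / L) \<subseteq> {x \<in> sphere 0 1. f x \<le> m + t}"
    proof
      fix x assume x: "x \<in> enlargement A (t / L)"
      then have xs: "norm x = 1" and "(INF a\<in>A. geodist x a) < t / L" by (auto simp: enlargement_def)
      then have "\<exists>y\<in>geodist x ` A. y < t / L"
        using cInf_lessD[of "geodist x ` A" "t / L"] ne by auto
      then obtain a where a: "a \<in> A" "geodist x a < t / L" by auto
      have "f x - f a \<le> L * geodist x a"
        using f a xs A by (force simp: geo_lipschitz_def abs_le_iff)
      also have "\<dots> < t" using a L by (simp add: pos_less_divide_eq mult.commute)
      finally show "x \<in> {x \<in> sphere 0 1. f x \<le> m + t}" using a xs by (simp add: A_def)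
    qed
    then have "measure \<mu> (enlargement A (t / L)) \<le> measure \<mu> {x \<in> sphere 0 1. f x \<le> m + t}"
      by (intro finite_measure_mono sub)
    moreover have "1 - 1/2 * exp (- (real CARD('n) * (t / L)\<^sup>2 / 2)) \<le> measure \<mu> (enlargement A (t / L))"
      by (rule sphere_prob_enlargement[OF n \<mu> t A])
    moreover have "real CARD('n) * (t / L)\<^sup>2 / 2 = real CARD('n) * t\<^sup>2 / (2 * L\<^sup>2)"
      by (simp add: power_divide mult.commute)
    ultimately show ?thesis by (simp only: compl)
  qed
qed

theorem theorem2:
  fixes \<mu> :: "(real ^ 'n) measure"
  assumes n: "CARD('n) > 2" and \<mu>: "sphere_prob \<mu>"
  shows
    "(\<forall>t A. t > 0 \<and> A \<subseteq> sphere 0 1 \<and> A \<in> sets borel \<and> measure \<mu> A \<ge> 1/2 \<longrightarrow>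
        measure \<mu> (enlargement A t) \<ge> 1 - 1/2 * exp (- (real CARD('n) * t\<^sup>2 / 2)))
     \<and>
     (\<forall>L f M. L > 0 \<and> geo_lipschitz L f \<and> is_median \<mu> f M \<longrightarrow>
        (\<forall>t\<ge>0.
           measure \<mu> {x \<in> sphere 0 1. f x > M + t}
             \<le> 1/2 * exp (- (real CARD('n) * t\<^sup>2 / (2 * L\<^sup>2))) \<and>
           measure \<mu> {x \<in> sphere 0 1. \<bar>f x - M\<bar> > t}
             \<le> exp (- (real CARD('n) * t\<^sup>2 / (2 * L\<^sup>2)))))"
proof (intro conjI allI impI; (elim conjE)?)
  fix t :: real and A
  assume "t > 0" "A \<subseteq> sphere 0 1" "A \<in> sets borel" "measure \<mu> A \<ge> 1/2"
  then show "measure \<mu> (enlargement A t) \<ge> 1 - 1/2 * exp (- (real CARD('n) * t\<^sup>2 / 2))"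
    by (rule sphere_prob_enlargement[OF n \<mu>])
next
  fix L f M and t :: real
  assume L: "L > 0" and f: "geo_lipschitz L f" and M: "is_median \<mu> f M" and t: "0 \<le> t"
  let ?E = "exp (- (real CARD('n) * t\<^sup>2 / (2 * L\<^sup>2)))"
  interpret prob_space \<mu> using \<mu> by (simp add: sphere_prob_def)
  \<comment> \<open>The lower tail of \<open>f\<close> is the upper tail of \<open>- f\<close>, for
    which \<open>- M\<close> takes the place of the median.\<close>
  have g: "geo_lipschitz L (\<lambda>x. - f x)"
    using f by (simp add: geo_lipschitz_def abs_minus_commute)
  have sp: "space \<mu> = sphere 0 1" by (rule space_sphere_prob[OF \<mu>])
  show up: "measure \<mu> {x \<in> sphere 0 1. M + t < f x} \<le> 1/2 * ?E"
    using M by (intro sphere_prob_upper_tail n \<mu> L f t) (simp add: is_median_def sp)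
  have lo: "measure \<mu> {x \<in> sphere 0 1. - M + t < - f x} \<le> 1/2 * ?E"
    using M by (intro sphere_prob_upper_tail n \<mu> L g t) (simp add: is_median_def sp)
  have above: "{x \<in> sphere 0 1. c < h x} \<in> sets \<mu>" if "geo_lipschitz L h" for c h
  proof -
    have "{x \<in> sphere 0 1. h x \<le> c} \<in> sets \<mu>"
      using borel_geo_lipschitz_sublevel[OF that] by (auto simp: sets_sphere_prob[OF \<mu>])
    moreover have "{x \<in> sphere 0 1. c < h x} = space \<mu> - {x \<in> sphere 0 1. h x \<le> c}"
      by (auto simp: sp)
    ultimately show ?thesis by simp
  qed
  have "{x \<in> sphere 0 1. \<bar>f x - M\<bar> > t}
      = {x \<in> sphere 0 1. M + t < f x} \<union> {x \<in> sphere 0 1. - M + t < - f x}"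
    by auto
  then have "measure \<mu> {x \<in> sphere 0 1. \<bar>f x - M\<bar> > t}
      \<le> measure \<mu> {x \<in> sphere 0 1. M + t < f x} + measure \<mu> {x \<in> sphere 0 1. - M + t < - f x}"
    using measure_Un_le[OF above[OF f] above[OF g]] by simp
  then show "measure \<mu> {x \<in> sphere 0 1. \<bar>f x - M\<bar> > t} \<le> ?E"
    using up lo by linarith
qed

end
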